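(* Let $n\ge1$, let $\lambda,\mu,\nu,\rho$ be partitions of length $n$ and let $\kappa$ be a partition of length $2n$. Then $$c_{\lambda/\mu,\nu/\rho}^{\kappa}=\big|\mathrm{SkewHive}_{\lambda/\mu,\nu/\rho}^{\kappa}\big|.$$
   Context: A partition of length $m$ is a weakly decreasing sequence of $m$ nonnegative integers. $c_{\lambda/\mu,\nu/\rho}^\kappa$ is the coefficient of $s_\kappa$ in the product $s_{\lambda/\mu}s_{\nu/\rho}$ of skew Schur functions ($s_{\lambda/\mu}=0$ if $\mu\not\subseteq\lambda$). Let $\Delta_{m}=\{(i,j)\in\mathbb{Z}_{\ge0}^2: i+j\le m\}$. A skew hive is a function $h:\Delta_{2n}\to\mathbb{Z}$ such that, for all $(i,j)$ for which all indices occurring lie in $\Delta_{2n}$: $$h_{i,j}+h_{i+1,j}\ge h_{i,j+1}+h_{i+1,j-1},$$ $$h_{i,j}+h_{i,j+1}\ge h_{i+1,j}+h_{i-1,j+1},$$ $$h_{i+1,j}+h_{i,j+1}\ge h_{i,j}+h_{i+1,j+1}\quad\text{whenever } i+j\ne n-1.$$ Define $h^{\uparrow}=(h_{0,1}-h_{0,0},\,h_{0,2}-h_{0,1},\ldots,h_{0,2n}-h_{0,2n-1})$, $h^{\rightarrow}=(h_{1,0}-h_{0,0},\,h_{2,0}-h_{1,0},\ldots,h_{2n,0}-h_{2n-1,0})$, $h^{\nwarrow}=(h_{2n-1,1}-h_{2n,0},\,h_{2n-2,2}-h_{2n-1,1},\ldots,h_{0,2n}-h_{1,2n-1})$. $\mathrm{SkewHive}_{\lambda/\mu,\nu/\rho}^{\kappa}$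 is the set of skew hives with $h_{0,0}=0$, $h^\uparrow=(\lambda_1,\ldots,\lambda_n,\nu_1,\ldots,\nu_n)$, $h^\rightarrow=(\mu_1,\ldots,\mu_n,\rho_1,\ldots,\rho_n)$ and $h^\nwarrow=\kappa$. *)

theory Defs
  imports Main "HOL-Library.Multiset" "HOL-Library.FuncSet"
begin

text \<open>
  A partition of length m is encoded as its zero-padded sequence of parts, indexed from 0: the
  part \<open>\<lambda>\<^sub>i\<close> of the usual notation is the value at \<open>i - 1\<close>. In this encoding partitions differing
  only in trailing zeros are equal, so that distinct partitions have distinct Schur functions.
\<close>

definition partition_of_length :: "nat \<Rightarrow> (nat \<Rightarrow> nat) \<Rightarrow> bool" where
  "partition_of_length m p \<longleftrightarrow> (\<forall>i j. i \<le> j \<longrightarrow> p j \<le> p i) \<and> (\<forall>i\<ge>m. p i = 0)"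

definition partitions :: "(nat \<Rightarrow> nat) set" where
  "partitions = {p. \<exists>m. partition_of_length m p}"


definition skew_diagram :: "(nat \<Rightarrow> nat) \<Rightarrow> (nat \<Rightarrow> nat) \<Rightarrow> (nat \<times> nat) set" where
  "skew_diagram la \<mu> = {(i, j). \<mu> i \<le> j \<and> j < la i}"

definition skew_SSYT :: "(nat \<Rightarrow> nat) \<Rightarrow> (nat \<Rightarrow> nat) \<Rightarrow> (nat \<times> nat \<Rightarrow> nat) set" where
  "skew_SSYT la \<mu> = {T \<in> skew_diagram la \<mu> \<rightarrow>\<^sub>E UNIV.
     (\<forall>i j. (i, j) \<in> skew_diagram la \<mu> \<longrightarrow> (i, j + 1) \<in> skew_diagram la \<mu> \<longrightarrow>
        T (i, j) \<le> T (i, j + 1)) \<and>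
     (\<forall>i j. (i, j) \<in> skew_diagram la \<mu> \<longrightarrow> (i + 1, j) \<in> skew_diagram la \<mu> \<longrightarrow>
        T (i, j) < T (i + 1, j))}"

text \<open>
  Formal power series with integer coefficients in the variables \<open>x\<^sub>0, x\<^sub>1, x\<^sub>2, \<dots>\<close>: a monomial is the
  multiset of the indices of its variables, and a series maps each monomial to its coefficient.
\<close>

type_synonym series = "nat multiset \<Rightarrow> int"

definition series_mult :: "series \<Rightarrow> series \<Rightarrow> series" where
  "series_mult f g = (\<lambda>M. \<Sum>(A, B) \<in> {(A, B). A + B = M}. f A * g B)"

definition content :: "(nat \<Rightarrow> nat) \<Rightarrow> (nat \<Rightarrow> nat) \<Rightarrow> (nat \<times> nat \<Rightarrow> nat) \<Rightarrow> nat multiset" where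
  "content la \<mu> T = image_mset T (mset_set (skew_diagram la \<mu>))"

definition skew_schur :: "(nat \<Rightarrow> nat) \<Rightarrow> (nat \<Rightarrow> nat) \<Rightarrow> series" where
  "skew_schur la \<mu> =
     (if \<forall>i. \<mu> i \<le> la i
      then (\<lambda>M. int (card {T \<in> skew_SSYT la \<mu>. content la \<mu> T = M}))
      else (\<lambda>M. 0))"

definition schur :: "(nat \<Rightarrow> nat) \<Rightarrow> series" where
  "schur la = skew_schur la (\<lambda>i. 0)"

text \<open>
  The Schur functions form a basis of the ring of symmetric functions, so every symmetric function
  has exactly one expansion as below.
\<close>

definition schur_expansion :: "series \<Rightarrow> ((nat \<Rightarrow> nat) \<Rightarrow> int) \<Rightarrow> bool" where
  "schur_expansion f c \<longleftrightarrow>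
     finite {\<kappa>. c \<kappa> \<noteq> 0} \<and> {\<kappa>. c \<kappa> \<noteq> 0} \<subseteq> partitions \<and>
     f = (\<lambda>M. \<Sum>\<kappa> \<in> {\<kappa>. c \<kappa> \<noteq> 0}. c \<kappa> * schur \<kappa> M)"

definition schur_coeff :: "series \<Rightarrow> (nat \<Rightarrow> nat) \<Rightarrow> int" where
  "schur_coeff f = (THE c. schur_expansion f c)"

definition skew_LR_coeff ::
    "(nat \<Rightarrow> nat) \<Rightarrow> (nat \<Rightarrow> nat) \<Rightarrow> (nat \<Rightarrow> nat) \<Rightarrow> (nat \<Rightarrow> nat) \<Rightarrow> (nat \<Rightarrow> nat) \<Rightarrow> int" where
  "skew_LR_coeff la \<mu> \<nu> \<rho> \<kappa> = schur_coeff (series_mult (skew_schur la \<mu>) (skew_schur \<nu> \<rho>)) \<kappa>"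


definition Delta :: "nat \<Rightarrow> (nat \<times> nat) set" where
  "Delta m = {(i, j). i + j \<le> m}"

text \<open>
  The conditions \<open>1 \<le> j\<close> and \<open>1 \<le> i\<close> below say that the truncated differences \<open>j - 1\<close> and \<open>i - 1\<close>
  are genuine indices; \<open>i + j + 1 \<noteq> n\<close> is \<open>i + j \<noteq> n - 1\<close> without truncated subtraction.
\<close>

definition skew_hive :: "nat \<Rightarrow> (nat \<times> nat \<Rightarrow> int) \<Rightarrow> bool" where
  "skew_hive n h \<longleftrightarrow>
     h \<in> Delta (2 * n) \<rightarrow>\<^sub>E UNIV \<and>
     (\<forall>i j. 1 \<le> j \<and> {(i, j), (i + 1, j), (i, j + 1), (i + 1, j - 1)} \<subseteq> Delta (2 * n) \<longrightarrow>
        h (i, j) + h (i + 1, j) \<ge> h (i, j + 1) + h (i + 1, j - 1)) \<and>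
     (\<forall>i j. 1 \<le> i \<and> {(i, j), (i, j + 1), (i + 1, j), (i - 1, j + 1)} \<subseteq> Delta (2 * n) \<longrightarrow>
        h (i, j) + h (i, j + 1) \<ge> h (i + 1, j) + h (i - 1, j + 1)) \<and>
     (\<forall>i j. {(i + 1, j), (i, j + 1), (i, j), (i + 1, j + 1)} \<subseteq> Delta (2 * n) \<and> i + j + 1 \<noteq> n \<longrightarrow>
        h (i + 1, j) + h (i, j + 1) \<ge> h (i, j) + h (i + 1, j + 1))"

definition up_diff :: "(nat \<times> nat \<Rightarrow> int) \<Rightarrow> nat \<Rightarrow> int" where
  "up_diff h k = h (0, k + 1) - h (0, k)"

definition right_diff :: "(nat \<times> nat \<Rightarrow> int) \<Rightarrow> nat \<Rightarrow> int" where
  "right_diff h k = h (k + 1, 0) - h (k, 0)"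

definition nw_diff :: "nat \<Rightarrow> (nat \<times> nat \<Rightarrow> int) \<Rightarrow> nat \<Rightarrow> int" where
  "nw_diff n h k = h (2 * n - (k + 1), k + 1) - h (2 * n - k, k)"

definition concat_seq :: "nat \<Rightarrow> (nat \<Rightarrow> nat) \<Rightarrow> (nat \<Rightarrow> nat) \<Rightarrow> nat \<Rightarrow> nat" where
  "concat_seq n p q k = (if k < n then p k else q (k - n))"

definition SkewHive ::
    "nat \<Rightarrow> (nat \<Rightarrow> nat) \<Rightarrow> (nat \<Rightarrow> nat) \<Rightarrow> (nat \<Rightarrow> nat) \<Rightarrow> (nat \<Rightarrow> nat) \<Rightarrow> (nat \<Rightarrow> nat) \<Rightarrow>
     (nat \<times> nat \<Rightarrow> int) set" where
  "SkewHive n la \<mu> \<nu> \<rho> \<kappa> = {h. skew_hive n h \<and> h (0, 0) = 0 \<and>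
     (\<forall>k < 2 * n. up_diff h k = int (concat_seq n la \<nu> k)) \<and>
     (\<forall>k < 2 * n. right_diff h k = int (concat_seq n \<mu> \<rho> k)) \<and>
     (\<forall>k < 2 * n. nw_diff n h k = int (\<kappa> k))}"

end

theory Submission imports Defs begin

text \<open>
  The proof reads a skew hive as a semistandard tableau of shape \<open>\<kappa>\<close> and obtains the expansion of
  \<open>s\<^bsub>\<lambda>/\<mu>\<^esub> s\<^bsub>\<nu>/\<rho>\<^esub>\<close> from a Robinson-Schensted-Knuth correspondence in which the insertion tableau keeps
  track of the skew shapes.

  Put \<open>v = (\<lambda>, \<nu>)\<close> and \<open>u = (\<mu>, \<rho>)\<close>, both of length \<open>m = 2n\<close>. The differences of a hive along the
  antidiagonals \<open>i + j = k\<close>, for \<open>k = 0, \<dots>, m\<close>, are partitions that interlace, by the first two families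
  of rhombus inequalities. They form a Gelfand-Tsetlin pattern \<open>Q\<close> with top row \<open>\<kappa>\<close>, that is, a tableau
  of shape \<open>\<kappa>\<close>, and its content is \<open>v - u\<close>. The third family says that adding the letters of \<open>Q\<close> to
  \<open>u\<close>, row by row from the top and from right to left, never violates \<open>u\<^sub>k \<ge> u\<^bsub>k+1\<^esub>\<close>, except possibly
  at the border between the two blocks. So hives correspond to the patterns of \<open>lr_patterns\<close>
  (\<open>SkewHive_eq_image\<close>), and it has to be shown that these are counted by the Schur coefficients.

  A pair of tableaux of shapes \<open>\<lambda>/\<mu>\<close> and \<open>\<nu>/\<rho>\<close> is a filling of \<open>v/u\<close> in which columns increase within
  each block. Recording where the entries are at most \<open>x\<close> turns it into a chain of horizontal strips
  from \<open>u\<close> to \<open>v\<close>, and straight tableaux become chains from the empty partition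
  (\<open>card_tableaux_eq_chain_count\<close>). Row insertion of one strip \<open>u'/u\<close> into a pattern with content
  \<open>v - u'\<close> and shape \<open>p\<close> gives a pattern with content \<open>v - u\<close> whose shape exceeds \<open>p\<close> by a horizontal
  strip of the same size. In terms of patterns, insertion is a local rule that reflects numbers in
  intervals (\<open>local_rule\<close>), hence it is bijective, and a cancellation in the partial row sums shows that
  it respects the dominance condition (\<open>local_rule_dominance\<close>). The resulting Pieri rule
  \<open>lr_patterns_pieri\<close>, iterated along a chain from \<open>u\<close> to \<open>v\<close>, yields
  \<open>chain_count_eq_sum_lr_patterns\<close>: the number of chains is the sum over \<open>p\<close> of the number of patterns of
  shape \<open>p\<close> times the number of chains from the empty partition to \<open>p\<close> with the reversed list of strip
  sizes. Reversal is harmless because Schur functions are symmetric (\<open>strips_commute\<close>), and this is the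
  wanted Schur expansion. It is the only one, because Schur functions are unitriangular with respect
  to dominance order (\<open>schur_expansion_unique\<close>).
\<close>

section \<open>Horizontal strips and the local insertion rule\<close>

text \<open>
  With \<open>I = UNIV\<close> this is the usual condition that \<open>v/u\<close> is a horizontal strip. Leaving indices out of
  \<open>I\<close> cuts the rows into blocks that do not interact, which is how a product of skew Schur functions
  is treated as a single shape.
\<close>
definition hstrip :: "nat set \<Rightarrow> (nat \<Rightarrow> nat) \<Rightarrow> (nat \<Rightarrow> nat) \<Rightarrow> bool" where
  "hstrip I u v \<longleftrightarrow> (\<forall>k. u k \<le> v k) \<and> (\<forall>k\<in>I. v (Suc k) \<le> u k)"

text \<open>
  The rule completes a square of partitions with corners \<open>a\<close>, \<open>b\<close> (from \<open>a\<close> by old letters), \<open>A\<close> (from \<open>a\<close>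
  by inserted smaller letters) and \<open>B\<close>, when \<open>r\<close> copies of the current letter are inserted. This is
  Fomin's growth rule for row insertion: in row \<open>i\<close> the old letters and the shift from \<open>a\<close> to \<open>A\<close> collide
  in \<open>min (b i) (A i) - a i\<close> cells, which are bumped to row \<open>i + 1\<close>. Equivalently, \<open>B (i + 1)\<close> is the mirror
  image of \<open>a i\<close> in the interval of values allowed by the interlacing conditions.
\<close>
definition local_rule ::
    "(nat \<Rightarrow> nat) \<Rightarrow> (nat \<Rightarrow> nat) \<Rightarrow> (nat \<Rightarrow> nat) \<Rightarrow> nat \<Rightarrow> (nat \<Rightarrow> nat) \<Rightarrow> bool" where
  "local_rule a b A r B \<longleftrightarrow> B 0 = max (b 0) (A 0) + r \<and>
     (\<forall>i. B (Suc i) + a i = max (b (Suc i)) (A (Suc i)) + min (b i) (A i))"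

lemma hstrip_UNIV: "hstrip UNIV u v \<longleftrightarrow> (\<forall>k. u k \<le> v k \<and> v (Suc k) \<le> u k)"
  by (auto simp: hstrip_def)

text \<open>
  The reflection maps the interval between \<open>max (b (i + 1)) (A (i + 1))\<close> and \<open>min (b i) (A i)\<close> to itself,
  and these intervals are exactly the horizontal strip conditions on either side of the square.
\<close>
lemma local_rule_forward:
  assumes "hstrip UNIV a b" "hstrip UNIV a A"
  shows "\<exists>B. local_rule a b A r B \<and> hstrip UNIV b B \<and> hstrip UNIV A B"
proof -
  define B where "B = (\<lambda>i. case i of 0 \<Rightarrow> max (b 0) (A 0) + r
     | Suc i \<Rightarrow> max (b (Suc i)) (A (Suc i)) + min (b i) (A i) - a i)"
  have B0: "B 0 = max (b 0) (A 0) + r" by (simp add: B_def)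
  have a: "a i \<le> b i" "a i \<le> A i" "b (Suc i) \<le> a i" "A (Suc i) \<le> a i" for i
    using assms by (auto simp: hstrip_UNIV)
  have BS: "B (Suc i) + a i = max (b (Suc i)) (A (Suc i)) + min (b i) (A i)" for i
    using a[of i] by (simp add: B_def)
  have "b i \<le> B i \<and> A i \<le> B i \<and> B (Suc i) \<le> b i \<and> B (Suc i) \<le> A i" for i
  proof -
    have "b i \<le> B i \<and> A i \<le> B i"
    proof (cases i)
      case 0
      then show ?thesis using B0 unfolding 0 by linarith
    next
      case (Suc l)
      then show ?thesis using BS[of l] a[of l] unfolding Suc by linarith
    qed
    then show ?thesis using BS[of i] a[of i] by linarith
  qed
  then show ?thesis using B0 BS by (auto simp: local_rule_def hstrip_UNIV)
qed

lemma local_rule_unique_forward: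
  assumes "local_rule a b A r B" "local_rule a b A r B'"
  shows "B = B'"
proof
  fix i show "B i = B' i"
  proof (cases i)
    case 0
    then show ?thesis using assms by (simp add: local_rule_def)
  next
    case (Suc l)
    have "B (Suc l) + a l = B' (Suc l) + a l" using assms by (simp add: local_rule_def)
    then show ?thesis using Suc by simp
  qed
qed

lemma local_rule_backward:
  assumes "hstrip UNIV b B" "hstrip UNIV A B"
  shows "\<exists>a r. local_rule a b A r B \<and> hstrip UNIV a b \<and> hstrip UNIV a A"
proof -
  define a where "a i = max (b (Suc i)) (A (Suc i)) + min (b i) (A i) - B (Suc i)" for i
  have B: "b i \<le> B i" "A i \<le> B i" "B (Suc i) \<le> b i" "B (Suc i) \<le> A i" for i
    using assms by (auto simp: hstrip_UNIV)
  have BS: "B (Suc i) + a i = max (b (Suc i)) (A (Suc i)) + min (b i) (A i)" for i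
    using B[of i] by (simp add: a_def)
  have "a i \<le> b i \<and> a i \<le> A i \<and> b (Suc i) \<le> a i \<and> A (Suc i) \<le> a i" for i
    using BS[of i] B[of i] B[of "Suc i"] by linarith
  moreover have "B 0 = max (b 0) (A 0) + (B 0 - max (b 0) (A 0))" using B[of 0] by simp
  ultimately show ?thesis using BS unfolding local_rule_def hstrip_UNIV by blast
qed

lemma local_rule_unique_backward:
  assumes "local_rule a b A r B" "local_rule a' b A r' B"
  shows "a = a' \<and> r = r'"
proof
  show "a = a'"
  proof
    fix i
    have "B (Suc i) + a i = B (Suc i) + a' i" using assms by (simp add: local_rule_def)
    then show "a i = a' i" by simp
  qed
qed (use assms in \<open>auto simp: local_rule_def\<close>)

lemma local_rule_zero:
  assumes "hstrip UNIV p q"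
  shows "local_rule p p q 0 q"
  using assms by (simp add: local_rule_def hstrip_UNIV max_absorb2 min_absorb1)

text \<open>
  In partial sums the minimum of one row meets the maximum of the same row, and
  \<open>max x y + min x y = x + y\<close>, so only the last maximum survives.
\<close>
lemma local_rule_sum:
  assumes "local_rule a b A r B"
  shows "sum B {..<Suc j} + sum a {..<j} = r + max (b j) (A j) + sum b {..<j} + sum A {..<j}"
proof (induction j)
  case 0 then show ?case using assms by (simp add: local_rule_def)
next
  case (Suc j)
  have "B (Suc j) + a j = max (b (Suc j)) (A (Suc j)) + min (b j) (A j)"
    using assms by (simp add: local_rule_def)
  then show ?case using Suc unfolding sum.lessThan_Suc by linarith
qed

lemma local_rule_total:
  assumes "local_rule a b A r B" "b m = 0" "A m = 0" "B m = 0"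
  shows "sum B {..<m} + sum a {..<m} = r + sum b {..<m} + sum A {..<m}"
  using local_rule_sum[OF assms(1), of m] assms by simp

text \<open>
  Two adjacent squares, for the letters \<open>k\<close> and \<open>k + 1\<close>, with inserted multiplicities \<open>r\<close> and \<open>s\<close>. The
  left-hand side is the dominance condition after the insertion, with starting heights \<open>u\<close> and \<open>u'\<close> of
  the rows \<open>k\<close> and \<open>k + 1\<close>. The right-hand side lets the inserted row be read first: the strip with \<open>r\<close>
  and \<open>s\<close> cells is horizontal, and the old pattern is dominant over the enlarged heights. By the
  formula for partial sums, both sides are conjunctions of the same inequalities \<open>X j\<close> and \<open>Y j\<close>. After
  insertion, the maximum for row \<open>j\<close> pairs \<open>X j\<close> with \<open>Y j\<close>; before insertion, it pairs \<open>Y j\<close> with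
  \<open>X (j + 1)\<close>; and \<open>X 0\<close> is the strip condition.
\<close>
lemma local_rule_dominance:
  assumes AB: "local_rule a b A r B" and BC: "local_rule b c B s C"
  shows "(\<forall>j. u' + sum C {..<Suc j} + sum A {..<j} \<le> u + sum B {..<j} + sum B {..<Suc j}) \<longleftrightarrow>
    u' + s \<le> u \<and>
    (\<forall>j. u' + s + sum c {..<Suc j} + sum a {..<j} \<le> u + r + sum b {..<j} + sum b {..<Suc j})"
    (is "(\<forall>j. ?P j) \<longleftrightarrow> _ \<and> (\<forall>j. ?P' j)")
proof -
  note B = local_rule_sum[OF AB] note C = local_rule_sum[OF BC]
  define X where "X j \<longleftrightarrow> u' + s + sum c {..<j} + sum A {..<j} \<le> u + sum b {..<j} + sum B {..<j}" for j
  define Y where "Y j \<longleftrightarrow> u' + s + sum c {..<Suc j} + sum A {..<j} \<le> u + sum b {..<j} + sum B {..<Suc j}" for j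
  have P: "?P j \<longleftrightarrow> X j \<and> Y j" for j
  proof -
    have "sum C {..<Suc j} + sum b {..<j} = s + max (c j) (B j) + sum c {..<j} + sum B {..<j}"
      by (rule C)
    then show ?thesis
      unfolding X_def Y_def sum.lessThan_Suc
      by (intro iffI conjI; linarith)
  qed
  have P': "?P' j \<longleftrightarrow> Y j \<and> X (Suc j)" for j
  proof -
    have "sum B {..<Suc j} + sum a {..<j} = r + max (b j) (A j) + sum b {..<j} + sum A {..<j}"
      by (rule B)
    then show ?thesis
      unfolding X_def Y_def sum.lessThan_Suc
      by (intro iffI conjI; linarith)
  qed
  have X0: "X 0 \<longleftrightarrow> u' + s \<le> u" by (simp add: X_def)
  have "X j" if "X 0" "\<And>j. X (Suc j)" for j using that by (cases j) auto
  then have "(\<forall>j. X j \<and> Y j) \<longleftrightarrow> X 0 \<and> (\<forall>j. Y j \<and> X (Suc j))" by blast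
  then show ?thesis unfolding P P' X0 .
qed

section \<open>Row insertion into Gelfand-Tsetlin patterns\<close>

text \<open>
  A pattern encodes a straight semistandard tableau: \<open>Q k\<close> is the shape of the cells with entries below
  \<open>k\<close>. Continuing it by constant rows beyond \<open>m\<close> spares boundary cases in the conditions on
  consecutive rows.
\<close>
definition gt_pattern :: "nat \<Rightarrow> (nat \<Rightarrow> nat \<Rightarrow> nat) \<Rightarrow> bool" where
  "gt_pattern m Q \<longleftrightarrow> Q 0 = (\<lambda>_. 0) \<and> (\<forall>k. hstrip UNIV (Q k) (Q (Suc k))) \<and> (\<forall>k\<ge>m. Q k = Q m)"

definition row_insertion ::
    "(nat \<Rightarrow> nat \<Rightarrow> nat) \<Rightarrow> (nat \<Rightarrow> nat) \<Rightarrow> (nat \<Rightarrow> nat \<Rightarrow> nat) \<Rightarrow> bool" where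
  "row_insertion Q' r Q \<longleftrightarrow> (\<forall>k. local_rule (Q' k) (Q' (Suc k)) (Q k) (r k) (Q (Suc k)))"

lemma gt_pattern_0: "gt_pattern m Q \<Longrightarrow> Q 0 = (\<lambda>_. 0)"
  and gt_pattern_step: "gt_pattern m Q \<Longrightarrow> hstrip UNIV (Q k) (Q (Suc k))"
  and gt_pattern_stable: "gt_pattern m Q \<Longrightarrow> m \<le> k \<Longrightarrow> Q k = Q m"
  unfolding gt_pattern_def by blast+

lemma gt_pattern_mono:
  assumes "gt_pattern m Q" "k \<le> l"
  shows "Q k i \<le> Q l i"
proof (rule lift_Suc_mono_le[of "\<lambda>k. Q k i", OF _ assms(2)])
  fix n show "Q n i \<le> Q (Suc n) i" using gt_pattern_step[OF assms(1)] by (simp add: hstrip_UNIV)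
qed

lemma gt_pattern_le_last:
  assumes "gt_pattern m Q"
  shows "Q k i \<le> Q m i"
proof (cases "k \<le> m")
  case True then show ?thesis by (rule gt_pattern_mono[OF assms])
next
  case False
  then have "Q k = Q m" by (intro gt_pattern_stable[OF assms]) simp
  then show ?thesis by simp
qed

lemma gt_pattern_support:
  assumes "gt_pattern m Q"
  shows "k \<le> i \<Longrightarrow> Q k i = 0"
proof (induction k arbitrary: i)
  case 0 then show ?case by (simp add: gt_pattern_0[OF assms])
next
  case (Suc k)
  then obtain l where l: "i = Suc l" "k \<le> l" by (cases i) auto
  then have "Q (Suc k) i \<le> Q k l" using gt_pattern_step[OF assms, of k] by (simp add: hstrip_UNIV)
  then show ?case using Suc.IH[OF l(2)] by simp
qed

lemma gt_pattern_rows: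
  assumes "gt_pattern m Q" "m \<le> i"
  shows "Q k i = 0"
  using gt_pattern_le_last[OF assms(1), of k i] gt_pattern_support[OF assms(1) assms(2)] by simp

lemma row_insertion_unique:
  assumes "row_insertion Q' r Q1" "row_insertion Q' r Q2" "Q1 0 = Q2 0"
  shows "Q1 = Q2"
proof
  fix k show "Q1 k = Q2 k"
  proof (induction k)
    case (Suc k)
    then show ?case using assms local_rule_unique_forward unfolding row_insertion_def by metis
  qed (use assms in simp)
qed

text \<open>
  The squares are filled in from row \<open>0\<close> upwards; once no letters are left, the rule reproduces the
  last row.
\<close>
lemma row_insertion_exists:
  assumes Q': "gt_pattern m Q'" and r: "\<And>k. k \<ge> m \<Longrightarrow> r k = 0"
  shows "\<exists>Q. gt_pattern m Q \<and> row_insertion Q' r Q \<and> (\<forall>k. hstrip UNIV (Q' k) (Q k))"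
proof -
  have "\<exists>Q. \<forall>k. (hstrip UNIV (Q' k) (Q k) \<and> (k = 0 \<longrightarrow> Q k = (\<lambda>_. 0))) \<and>
      local_rule (Q' k) (Q' (Suc k)) (Q k) (r k) (Q (Suc k)) \<and> hstrip UNIV (Q k) (Q (Suc k))"
  proof (rule dependent_nat_choice)
    show "\<exists>x. hstrip UNIV (Q' 0) x \<and> ((0::nat) = 0 \<longrightarrow> x = (\<lambda>_. 0))"
      using gt_pattern_0[OF Q'] by (auto simp: hstrip_UNIV)
  next
    fix A k assume "hstrip UNIV (Q' k) A \<and> (k = 0 \<longrightarrow> A = (\<lambda>_. 0))"
    then show "\<exists>B. (hstrip UNIV (Q' (Suc k)) B \<and> (Suc k = 0 \<longrightarrow> B = (\<lambda>_. 0))) \<and>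
        local_rule (Q' k) (Q' (Suc k)) A (r k) B \<and> hstrip UNIV A B"
      using local_rule_forward[of "Q' k" "Q' (Suc k)" A "r k"] gt_pattern_step[OF Q'] by auto
  qed
  then obtain Q where Q: "\<And>k. hstrip UNIV (Q' k) (Q k)" "Q 0 = (\<lambda>_. 0)"
      "\<And>k. local_rule (Q' k) (Q' (Suc k)) (Q k) (r k) (Q (Suc k))"
      "\<And>k. hstrip UNIV (Q k) (Q (Suc k))" by blast
  have step: "Q (Suc k) = Q k" if "k \<ge> m" for k
  proof -
    have "Q' (Suc k) = Q' k" using gt_pattern_stable[OF Q'] that by (metis le_SucI)
    moreover have "local_rule (Q' k) (Q' k) (Q k) 0 (Q k)"
      using Q(1)[of k] by (rule local_rule_zero)
    ultimately show ?thesis using Q(3)[of k] r[OF that] local_rule_unique_forward by metis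
  qed
  have "Q k = Q m" if "k \<ge> m" for k
    using that by (induction k rule: dec_induct) (auto simp: step)
  then show ?thesis using Q unfolding gt_pattern_def row_insertion_def by blast
qed

text \<open>
  Insertion is undone from the top row downwards: the shape \<open>p\<close> before the insertion determines the
  last square, hence the number of inserted letters \<open>m - 1\<close> and the next smaller row, and so on.
\<close>
lemma row_extraction_exists:
  assumes Q: "gt_pattern m Q" and p: "hstrip UNIV p (Q m)"
  shows "\<exists>Q' r. gt_pattern m Q' \<and> Q' m = p \<and> (\<forall>k\<ge>m. r k = 0) \<and> row_insertion Q' r Q"
proof -
  \<comment> \<open>The part of the insertion diagram below row \<open>l\<close>, given its top row \<open>q\<close>.\<close>
  define ext where "ext l q Q' r \<longleftrightarrow> Q' l = q \<and> (\<forall>k\<le>l. hstrip UNIV (Q' k) (Q k)) \<and>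
      (\<forall>k<l. local_rule (Q' k) (Q' (Suc k)) (Q k) (r k) (Q (Suc k)) \<and> hstrip UNIV (Q' k) (Q' (Suc k)))"
    for l q Q' r
  have "\<exists>Q' r. ext l q Q' r" if "hstrip UNIV q (Q l)" for l q
    using that
  proof (induction l arbitrary: q)
    case 0
    then have "ext 0 q (\<lambda>_. q) (\<lambda>_. 0)" by (simp add: ext_def)
    then show ?case by blast
  next
    case (Suc l)
    have "hstrip UNIV (Q l) (Q (Suc l))" by (rule gt_pattern_step[OF Q])
    then obtain a s where a: "local_rule a q (Q l) s (Q (Suc l))" "hstrip UNIV a q" "hstrip UNIV a (Q l)"
      using local_rule_backward Suc.prems by blast
    obtain Q' r where E: "ext l a Q' r"
      using Suc.IH[OF a(3)] by blast
    define P where "P = Q'(Suc l := q)"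
    define t where "t = r(l := s)"
    have "hstrip UNIV (P k) (Q k)" if "k \<le> Suc l" for k
      using that E Suc.prems by (cases "k = Suc l") (simp_all add: P_def ext_def)
    moreover have "local_rule (P k) (P (Suc k)) (Q k) (t k) (Q (Suc k)) \<and> hstrip UNIV (P k) (P (Suc k))"
      if "k < Suc l" for k
    proof (cases "k = l")
      case True then show ?thesis using a E by (simp add: P_def t_def ext_def)
    next
      case False then show ?thesis using that E by (simp add: P_def t_def ext_def)
    qed
    ultimately have "ext (Suc l) q P t" by (simp add: ext_def P_def)
    then show ?case by blast
  qed
  from this[OF p] obtain Q' r where "ext m p Q' r" by blast
  then have Q': "Q' m = p" "\<And>k. k \<le> m \<Longrightarrow> hstrip UNIV (Q' k) (Q k)"
      "\<And>k. k < m \<Longrightarrow> local_rule (Q' k) (Q' (Suc k)) (Q k) (r k) (Q (Suc k)) \<and> hstrip UNIV (Q' k) (Q' (Suc k))"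
    by (simp_all add: ext_def)
  define P where "P k = Q' (min k m)" for k
  define s where "s k = (if k < m then r k else 0)" for k
  have pQ: "local_rule p p (Q m) 0 (Q m)"
    using p by (rule local_rule_zero)
  have pp: "hstrip UNIV p p" unfolding hstrip_UNIV
  proof
    fix k
    have "p (Suc k) \<le> Q m (Suc k)" "Q m (Suc k) \<le> p k" using p by (auto simp: hstrip_UNIV)
    then show "p k \<le> p k \<and> p (Suc k) \<le> p k" by simp
  qed
  have Qm: "Q k = Q m" if "k \<ge> m" for k by (rule gt_pattern_stable[OF Q that])
  have 1: "local_rule (P k) (P (Suc k)) (Q k) (s k) (Q (Suc k)) \<and> hstrip UNIV (P k) (P (Suc k))" for k
  proof (cases "k < m")
    case True then show ?thesis using Q'(3)[OF True] by (simp add: P_def s_def min_def)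
  next
    case False then show ?thesis
      using pQ pp Qm[of k] Qm[of "Suc k"] Q'(1) by (simp add: P_def s_def min_def)
  qed
  have "P 0 = (\<lambda>_. 0)" using Q'(2)[of 0] gt_pattern_0[OF Q] by (simp add: P_def hstrip_UNIV fun_eq_iff)
  moreover have "P k = P m" if "k \<ge> m" for k using that by (simp add: P_def)
  ultimately have "gt_pattern m P" using 1 unfolding gt_pattern_def by blast
  moreover have "P m = p" "\<forall>k\<ge>m. s k = 0" using Q'(1) by (simp_all add: P_def s_def)
  moreover have "row_insertion P s Q" using 1 by (simp add: row_insertion_def)
  ultimately show ?thesis by blast
qed

lemma row_extraction_unique:
  assumes R: "row_insertion Q1 r1 Q" "row_insertion Q2 r2 Q" and m: "Q1 m = Q2 m"
  shows "k \<le> m \<Longrightarrow> Q1 k = Q2 k" and "k < m \<Longrightarrow> r1 k = r2 k"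
proof -
  have step: "Q1 k = Q2 k \<and> r1 k = r2 k" if "Q1 (Suc k) = Q2 (Suc k)" for k
    using R that local_rule_unique_backward unfolding row_insertion_def by metis
  have Q: "Q1 k = Q2 k" if "k \<le> m" for k
    using that by (induction k rule: inc_induct) (auto simp: m step)
  show "k \<le> m \<Longrightarrow> Q1 k = Q2 k" by (fact Q)
  show "k < m \<Longrightarrow> r1 k = r2 k" using step[of k] Q[of "Suc k"] by simp
qed

section \<open>Littlewood-Richardson patterns and their Pieri rule\<close>

text \<open>
  The sum of \<open>Q (Suc k)\<close> minus that of \<open>Q k\<close> over the first rows counts the letters \<open>k\<close> in these rows. So
  the inequality says: when the counts start at \<open>u k\<close> and \<open>u (k + 1)\<close> and the tableau is read row by row,
  each row from right to left, then \<open>k + 1\<close> is not ahead of \<open>k\<close> once the letters \<open>k + 1\<close> of row \<open>j\<close> have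
  been read. The letters \<open>k\<close> of row \<open>j\<close> come later, whence the two different bounds \<open>j\<close> and \<open>j + 1\<close>.
\<close>
definition dominant :: "nat set \<Rightarrow> (nat \<Rightarrow> nat) \<Rightarrow> (nat \<Rightarrow> nat \<Rightarrow> nat) \<Rightarrow> bool" where
  "dominant I u Q \<longleftrightarrow> (\<forall>k\<in>I. \<forall>j.
     u (Suc k) + sum (Q (Suc (Suc k))) {..<Suc j} + sum (Q k) {..<j}
       \<le> u k + sum (Q (Suc k)) {..<j} + sum (Q (Suc k)) {..<Suc j})"

text \<open>
  Tableaux of shape \<open>p\<close> and content \<open>v - u\<close> that are lattice relative to \<open>u\<close>. For \<open>I = UNIV\<close> and
  partitions \<open>u\<close> and \<open>v\<close> of length \<open>m\<close>, their number is the usual Littlewood-Richardson coefficient.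
\<close>
definition lr_patterns ::
    "nat set \<Rightarrow> nat \<Rightarrow> (nat \<Rightarrow> nat) \<Rightarrow> (nat \<Rightarrow> nat) \<Rightarrow> (nat \<Rightarrow> nat) \<Rightarrow> (nat \<Rightarrow> nat \<Rightarrow> nat) set" where
  "lr_patterns I m u v p = {Q. gt_pattern m Q \<and> Q m = p \<and>
     (\<forall>k. sum (Q (Suc k)) {..<m} + u k = sum (Q k) {..<m} + v k) \<and> dominant I u Q}"

text \<open>
  Content is additive over each square of the insertion, and dominance is compared by
  \<open>local_rule_dominance\<close> for every pair of consecutive letters.
\<close>
lemma row_insertion_lr_patterns:
  assumes Q': "gt_pattern m Q'" and Q: "gt_pattern m Q" and R: "row_insertion Q' r Q"
  shows "Q' \<in> lr_patterns I m (\<lambda>k. u k + r k) v (Q' m) \<and> hstrip I u (\<lambda>k. u k + r k) \<longleftrightarrow>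
    Q \<in> lr_patterns I m u v (Q m)"
proof -
  have "sum (Q (Suc k)) {..<m} + sum (Q' k) {..<m} = r k + sum (Q' (Suc k)) {..<m} + sum (Q k) {..<m}" for k
    using R gt_pattern_rows[OF Q order_refl] gt_pattern_rows[OF Q' order_refl]
    by (intro local_rule_total) (auto simp: row_insertion_def)
  then have content: "sum (Q (Suc k)) {..<m} + u k = sum (Q k) {..<m} + v k \<longleftrightarrow>
      sum (Q' (Suc k)) {..<m} + (u k + r k) = sum (Q' k) {..<m} + v k" for k
  proof -
    have "sum (Q (Suc k)) {..<m} + sum (Q' k) {..<m} = r k + sum (Q' (Suc k)) {..<m} + sum (Q k) {..<m}"
      by fact
    then show ?thesis by (intro iffI; linarith)
  qed
  have "dominant I u Q \<longleftrightarrow> hstrip I u (\<lambda>k. u k + r k) \<and> dominant I (\<lambda>k. u k + r k) Q'"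
  proof -
    have "local_rule (Q' k) (Q' (Suc k)) (Q k) (r k) (Q (Suc k))"
        "local_rule (Q' (Suc k)) (Q' (Suc (Suc k))) (Q (Suc k)) (r (Suc k)) (Q (Suc (Suc k)))" for k
      using R by (auto simp: row_insertion_def)
    note D = local_rule_dominance[OF this]
    show ?thesis unfolding dominant_def D hstrip_def by (auto simp del: sum.lessThan_Suc)
  qed
  then show ?thesis unfolding lr_patterns_def using Q Q' content by auto
qed

text \<open>
  The sums below range over these finite sets. If \<open>S\<close> is at least the size of the outer shape, no
  intermediate shape is lost.
\<close>
definition box :: "nat \<Rightarrow> nat \<Rightarrow> (nat \<Rightarrow> nat) set" where
  "box m S = {f. (\<forall>i. f i \<le> S) \<and> (\<forall>i\<ge>m. f i = 0)}"

definition strip :: "nat set \<Rightarrow> nat \<Rightarrow> nat \<Rightarrow> (nat \<Rightarrow> nat) \<Rightarrow> (nat \<Rightarrow> nat) \<Rightarrow> bool" where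
  "strip I m a u v \<longleftrightarrow> hstrip I u v \<and> sum v {..<m} = sum u {..<m} + a"

lemma box_downward:
  assumes "w \<in> box m S" "\<And>i. v i \<le> w i"
  shows "v \<in> box m S"
proof -
  have "v i \<le> S \<and> (m \<le> i \<longrightarrow> v i = 0)" for i
  proof -
    have "w i \<le> S" "m \<le> i \<Longrightarrow> w i = 0" using assms(1) by (auto simp: box_def)
    then show ?thesis using assms(2)[of i] by auto
  qed
  then show ?thesis by (simp add: box_def)
qed

lemma finite_box: "finite (box m S)"
proof -
  have "box m S \<subseteq> {f. \<forall>i. (i \<in> {..<m} \<longrightarrow> f i \<in> {..S}) \<and> (i \<notin> {..<m} \<longrightarrow> f i = 0)}"
    by (auto simp: box_def)
  then show ?thesis by (rule finite_subset) (rule finite_set_of_finite_funs; simp)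
qed

lemma lr_patterns_total:
  assumes "Q \<in> lr_patterns I m u v p"
  shows "sum p {..<m} + sum u {..<m} = sum v {..<m}"
proof -
  have "sum (Q k) {..<m} + sum u {..<k} = sum v {..<k}" for k
  proof (induction k)
    case 0 then show ?case using assms gt_pattern_0 by (auto simp: lr_patterns_def)
  next
    case (Suc k)
    have "sum (Q (Suc k)) {..<m} + u k = sum (Q k) {..<m} + v k"
      using assms by (simp add: lr_patterns_def)
    then show ?case using Suc by simp
  qed
  from this[of m] show ?thesis using assms by (simp add: lr_patterns_def)
qed

lemma lr_patterns_le:
  assumes "Q \<in> lr_patterns I m u v p"
  shows "u k \<le> v k"
proof -
  have Q: "gt_pattern m Q" "sum (Q (Suc k)) {..<m} + u k = sum (Q k) {..<m} + v k"
    using assms by (auto simp: lr_patterns_def)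
  have "sum (Q k) {..<m} \<le> sum (Q (Suc k)) {..<m}"
    by (intro sum_mono gt_pattern_mono[OF Q(1)]) simp
  then show ?thesis using Q(2) by simp
qed

lemma lr_patterns_box:
  assumes Q: "Q \<in> lr_patterns I m u v p" and S: "sum v {..<m} \<le> S"
  shows "Q k \<in> box m S"
proof -
  have g: "gt_pattern m Q" "Q m = p" using Q by (auto simp: lr_patterns_def)
  have "Q k i \<le> S" if "i < m" for i
  proof -
    have "Q k i \<le> p i" using gt_pattern_le_last[OF g(1)] g(2) by blast
    also have "\<dots> \<le> sum p {..<m}" using that by (intro member_le_sum) auto
    also have "\<dots> \<le> S" using lr_patterns_total[OF Q] S by simp
    finally show ?thesis .
  qed
  then show ?thesis unfolding box_def using gt_pattern_rows[OF g(1), of _ k]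
    by (intro CollectI conjI allI impI) (metis le0 linorder_not_le, blast)
qed

lemma finite_lr_patterns:
  "finite (lr_patterns I m u v p)"
proof -
  define X where "X = box m (sum v {..<m})"
  have "(\<lambda>Q. restrict Q {..m}) ` lr_patterns I m u v p \<subseteq> {..m} \<rightarrow>\<^sub>E X"
    using lr_patterns_box[of _ I m u v p] by (auto simp: X_def)
  then have "finite ((\<lambda>Q. restrict Q {..m}) ` lr_patterns I m u v p)"
    by (rule finite_subset) (auto intro!: finite_PiE simp: X_def finite_box)
  moreover have "inj_on (\<lambda>Q. restrict Q {..m}) (lr_patterns I m u v p)"
  proof (rule inj_onI)
    fix P Q assume PQ: "P \<in> lr_patterns I m u v p" "Q \<in> lr_patterns I m u v p"
      and eq: "restrict P {..m} = restrict Q {..m}"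
    have "P (min k m) = Q (min k m)" for k using fun_cong[OF eq, of "min k m"] by simp
    moreover have "P k = P (min k m)" "Q k = Q (min k m)" for k
      using PQ gt_pattern_stable[of m P k] gt_pattern_stable[of m Q k]
      by (auto simp: lr_patterns_def min_def)
    ultimately show "P = Q" by (metis ext)
  qed
  ultimately show ?thesis by (rule finite_imageD)
qed

lemma card_eq_by_relation:
  assumes "\<And>x. x \<in> A \<Longrightarrow> \<exists>y\<in>B. R x y" and "\<And>y. y \<in> B \<Longrightarrow> \<exists>x\<in>A. R x y"
    and "\<And>x y y'. x \<in> A \<Longrightarrow> y \<in> B \<Longrightarrow> y' \<in> B \<Longrightarrow> R x y \<Longrightarrow> R x y' \<Longrightarrow> y = y'"
    and "\<And>x x' y. x \<in> A \<Longrightarrow> x' \<in> A \<Longrightarrow> y \<in> B \<Longrightarrow> R x y \<Longrightarrow> R x' y \<Longrightarrow> x = x'"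
  shows "card A = card B"
proof -
  obtain f where f: "\<And>x. x \<in> A \<Longrightarrow> f x \<in> B \<and> R x (f x)" using assms(1) by metis
  have "bij_betw f A B"
    unfolding bij_betw_def
  proof
    show "inj_on f A" by (rule inj_onI) (metis assms(4) f)
    show "f ` A = B" using assms(2,3) f by (auto simp: image_iff) metis
  qed
  then show ?thesis by (rule bij_betw_same_card)
qed

text \<open>
  The bijection sends \<open>(u', Q')\<close> to the pattern obtained by inserting \<open>u' k - u k\<close> letters \<open>k\<close> for all \<open>k\<close>
  into \<open>Q'\<close>, together with its shape. The strip \<open>u'/u\<close> becomes the strip between the shapes.
\<close>
lemma lr_patterns_pieri:
  assumes u: "u \<in> box m S" and v: "v \<in> box m S" and S: "sum v {..<m} \<le> S"
  shows "(\<Sum>u' \<in> {u' \<in> box m S. strip I m a u u'}. card (lr_patterns I m u' v p)) =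
    (\<Sum>q \<in> {q \<in> box m S. strip UNIV m a p q}. card (lr_patterns I m u v q))"
proof -
  define A where "A = (SIGMA u' : {u' \<in> box m S. strip I m a u u'}. lr_patterns I m u' v p)"
  define B where "B = (SIGMA q : {q \<in> box m S. strip UNIV m a p q}. lr_patterns I m u v q)"
  define R where "R = (\<lambda>(u', Q') (q :: nat \<Rightarrow> nat, Q). row_insertion Q' (\<lambda>k. u' k - u k) Q)"
  have add: "(\<lambda>k. u k + (u' k - u k)) = u'" if "strip I m a u u'" for u'
    using that by (auto simp: strip_def hstrip_def)
  have "card A = card B"
  proof (rule card_eq_by_relation[where R = R])
    fix x assume "x \<in> A"
    then obtain u' Q' where x: "x = (u', Q')" and u': "u' \<in> box m S" "strip I m a u u'"
      and Q': "Q' \<in> lr_patterns I m u' v p" by (auto simp: A_def)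
    have g: "gt_pattern m Q'" and p: "Q' m = p" using Q' by (auto simp: lr_patterns_def)
    obtain Q where Q: "gt_pattern m Q" "row_insertion Q' (\<lambda>k. u' k - u k) Q" "hstrip UNIV (Q' m) (Q m)"
      using row_insertion_exists[OF g, of "\<lambda>k. u' k - u k"] u' by (auto simp: box_def)
    have L: "Q \<in> lr_patterns I m u v (Q m)"
      using row_insertion_lr_patterns[OF g Q(1,2), of I u v] Q' p u'(2) add[OF u'(2)]
      by (simp add: strip_def)
    have "sum (Q m) {..<m} = sum p {..<m} + a"
      using lr_patterns_total[OF L] lr_patterns_total[OF Q'] u'(2) by (simp add: strip_def)
    then have "(Q m, Q) \<in> B"
      using L lr_patterns_box[OF L S] Q(3) p by (auto simp: B_def strip_def)
    then show "\<exists>y\<in>B. R x y" using Q(2) x by (auto simp: R_def)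
  next
    fix y assume "y \<in> B"
    then obtain q Q where y: "y = (q, Q)" and q: "q \<in> box m S" "strip UNIV m a p q"
      and Q: "Q \<in> lr_patterns I m u v q" by (auto simp: B_def)
    have g: "gt_pattern m Q" and Qm: "Q m = q" using Q by (auto simp: lr_patterns_def)
    obtain Q' r where Q': "gt_pattern m Q'" "Q' m = p" "row_insertion Q' r Q"
      using row_extraction_exists[OF g, of p] q Qm by (auto simp: strip_def)
    define u' where "u' k = u k + r k" for k
    have L: "Q' \<in> lr_patterns I m u' v p" and h: "hstrip I u u'"
      using row_insertion_lr_patterns[OF Q'(1) g Q'(3), of I u v] Q Qm Q'(2)
      by (auto simp: u'_def[abs_def])
    have "u' \<in> box m S"
      by (rule box_downward[OF v lr_patterns_le[OF L]])
    moreover have "sum u' {..<m} = sum u {..<m} + a"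
      using lr_patterns_total[OF L] lr_patterns_total[OF Q] q(2) by (simp add: strip_def)
    ultimately have "(u', Q') \<in> A" using L h by (auto simp: A_def strip_def)
    moreover have "(\<lambda>k. u' k - u k) = r" by (simp add: u'_def)
    ultimately show "\<exists>x\<in>A. R x y" using Q'(3) y by (auto simp: R_def)
  next
    fix x y y' assume "x \<in> A" "y \<in> B" "y' \<in> B" "R x y" "R x y'"
    then obtain u' Q' q1 Q1 q2 Q2 where "y = (q1, Q1)" "y' = (q2, Q2)"
        "row_insertion Q' (\<lambda>k. u' k - u k) Q1" "row_insertion Q' (\<lambda>k. u' k - u k) Q2"
        "Q1 \<in> lr_patterns I m u v q1" "Q2 \<in> lr_patterns I m u v q2"
      by (auto simp: B_def R_def)
    moreover have "Q 0 = (\<lambda>_. 0)" "Q m = q" if "Q \<in> lr_patterns I m u v q" for Q q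
      using that gt_pattern_0 by (auto simp: lr_patterns_def)
    ultimately show "y = y'" using row_insertion_unique[of Q' "\<lambda>k. u' k - u k" Q1 Q2] by metis
  next
    fix x x' y assume H: "x \<in> A" "x' \<in> A" "y \<in> B" "R x y" "R x' y"
    obtain u1 Q1 u2 Q2 q Q where e: "x = (u1, Q1)" "x' = (u2, Q2)" "y = (q, Q)"
      by (metis surj_pair)
    have s: "strip I m a u u1" "strip I m a u u2" "u1 \<in> box m S" "u2 \<in> box m S"
      using H(1,2) e by (auto simp: A_def)
    have g: "gt_pattern m Q1" "gt_pattern m Q2" "Q1 m = p" "Q2 m = p"
      using H(1,2) e by (auto simp: A_def lr_patterns_def)
    have R: "row_insertion Q1 (\<lambda>k. u1 k - u k) Q" "row_insertion Q2 (\<lambda>k. u2 k - u k) Q"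
      using H(4,5) e by (auto simp: R_def)
    note ex = row_extraction_unique[OF R, of m]
    have "Q1 = Q2"
    proof
      fix k show "Q1 k = Q2 k"
      proof (cases "k \<le> m")
        case True then show ?thesis using ex(1)[of k] g by simp
      next
        case False
        then show ?thesis
          using gt_pattern_stable[OF g(1), of k] gt_pattern_stable[OF g(2), of k] g(3,4) by simp
      qed
    qed
    moreover have "u1 k = u2 k" for k
    proof (cases "k < m")
      case True
      then have "u1 k - u k = u2 k - u k" using ex(2)[of k] g by simp
      moreover have "u k \<le> u1 k" "u k \<le> u2 k" using s(1,2) by (simp_all add: strip_def hstrip_def)
      ultimately show ?thesis by linarith
    qed (use s in \<open>auto simp: box_def\<close>)
    ultimately show "x = x'" using e by auto
  qed
  moreover have "card A = (\<Sum>u' \<in> {u' \<in> box m S. strip I m a u u'}. card (lr_patterns I m u' v p))"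
    unfolding A_def by (rule card_SigmaI) (simp_all add: finite_box finite_lr_patterns)
  moreover have "card B = (\<Sum>q \<in> {q \<in> box m S. strip UNIV m a p q}. card (lr_patterns I m u v q))"
    unfolding B_def by (rule card_SigmaI) (simp_all add: finite_box finite_lr_patterns)
  ultimately show ?thesis by simp
qed

section \<open>Chains of horizontal strips\<close>

fun chain_count :: "nat set \<Rightarrow> nat \<Rightarrow> nat \<Rightarrow> nat list \<Rightarrow> (nat \<Rightarrow> nat) \<Rightarrow> (nat \<Rightarrow> nat) \<Rightarrow> nat" where
  "chain_count I m S [] u w = of_bool (u = w)"
| "chain_count I m S (a # as) u w = (\<Sum>v \<in> box m S. of_bool (strip I m a u v) * chain_count I m S as v w)"

lemma sum_of_bool_box:
  "(\<Sum>v \<in> box m S. of_bool (P v) * f v) = (\<Sum>v \<in> {v \<in> box m S. P v}. f v :: nat)"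
proof -
  have "(\<Sum>v \<in> box m S. of_bool (P v) * f v) = (\<Sum>v \<in> box m S. if P v then f v else 0)"
    by (intro sum.cong) auto
  then show ?thesis by (simp add: sum.inter_filter finite_box)
qed

lemma chain_count_snoc:
  assumes "u \<in> box m S" "w \<in> box m S"
  shows "chain_count I m S (as @ [a]) u w = (\<Sum>v \<in> box m S. chain_count I m S as u v * of_bool (strip I m a v w))"
  using assms(1)
proof (induction as arbitrary: u)
  case Nil
  have "(\<Sum>v \<in> box m S. of_bool (strip I m a u v) * of_bool (v = w)) =
      (\<Sum>v \<in> box m S. if v = w then of_bool (strip I m a u w) else (0::nat))"
    by (intro sum.cong) auto
  moreover have "(\<Sum>v \<in> box m S. of_bool (u = v) * of_bool (strip I m a v w)) =
      (\<Sum>v \<in> box m S. if v = u then of_bool (strip I m a u w) else (0::nat))"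
    by (intro sum.cong) auto
  ultimately show ?case using Nil assms(2) by (simp add: finite_box)
next
  case (Cons b as)
  have "chain_count I m S ((b # as) @ [a]) u w =
      (\<Sum>x \<in> box m S. of_bool (strip I m b u x) *
        (\<Sum>v \<in> box m S. chain_count I m S as x v * of_bool (strip I m a v w)))"
    using Cons.IH by simp
  also have "\<dots> = (\<Sum>v \<in> box m S. \<Sum>x \<in> box m S.
      of_bool (strip I m b u x) * (chain_count I m S as x v * of_bool (strip I m a v w)))"
    by (subst sum.swap) (simp add: sum_distrib_left)
  finally show ?case by (simp add: sum_distrib_right mult.assoc)
qed

lemma chain_count_le:
  assumes "chain_count I m S as u w \<noteq> 0"
  shows "u k \<le> w k"
  using assms
proof (induction as arbitrary: u)
  case (Cons a as)
  from sum.not_neutral_contains_not_neutral[OF Cons.prems[unfolded chain_count.simps]]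
  obtain v where v: "strip I m a u v" "chain_count I m S as v w \<noteq> 0" by auto
  have "u k \<le> v k" using v(1) by (simp add: strip_def hstrip_def)
  also have "v k \<le> w k" by (rule Cons.IH[OF v(2)])
  finally show ?case .
qed (simp split: if_splits)

lemma lr_patterns_zero_shape:
  assumes "\<And>k. k \<in> I \<Longrightarrow> u (Suc k) \<le> u k"
  shows "card (lr_patterns I m u v (\<lambda>_. 0)) = of_bool (u = v)"
proof -
  have 0: "Q = (\<lambda>_ _. 0)" if "Q \<in> lr_patterns I m u v (\<lambda>_. 0)" for Q
    using that gt_pattern_le_last[of m Q] by (fastforce simp: lr_patterns_def)
  have "lr_patterns I m u v (\<lambda>_. 0) = (if u = v then {\<lambda>_ _. 0} else {})"
  proof (cases "u = v")
    case True
    have "(\<lambda>_ _. 0) \<in> lr_patterns I m u v (\<lambda>_. 0)"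
      using assms True by (auto simp: lr_patterns_def gt_pattern_def hstrip_UNIV dominant_def)
    then have "lr_patterns I m u v (\<lambda>_. 0) = {\<lambda>_ _. 0}" using 0 by blast
    then show ?thesis using True by simp
  next
    case False
    have "Q \<notin> lr_patterns I m u v (\<lambda>_. 0)" for Q
    proof
      assume Q: "Q \<in> lr_patterns I m u v (\<lambda>_. 0)"
      then have "(\<lambda>_ _. 0) \<in> lr_patterns I m u v (\<lambda>_. 0)" using 0 by blast
      then have "u k = v k" for k by (simp add: lr_patterns_def)
      then show False using False by auto
    qed
    then have "lr_patterns I m u v (\<lambda>_. 0) = {}" by blast
    then show ?thesis using False by simp
  qed
  then show ?thesis by simp
qed

text \<open>
  The Pieri rule lets the first strip of the chain from \<open>u\<close> pass through the patterns and become the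
  last strip of a chain from the empty partition. This is why the list of sizes is reversed. What
  remains at the end of the chain is the single empty pattern.
\<close>
lemma chain_count_eq_sum_lr_patterns:
  assumes "u \<in> box m S" "v \<in> box m S" "sum v {..<m} \<le> S"
    and "\<And>k. k \<in> I \<Longrightarrow> u (Suc k) \<le> u k"
  shows "chain_count I m S as u v =
    (\<Sum>p \<in> box m S. card (lr_patterns I m u v p) * chain_count UNIV m S (rev as) (\<lambda>_. 0) p)"
  using assms(1,4)
proof (induction as arbitrary: u)
  case Nil
  have "(\<Sum>p \<in> box m S. card (lr_patterns I m u v p) * of_bool ((\<lambda>_. 0) = p)) =
      (\<Sum>p \<in> box m S. if p = (\<lambda>_. 0) then card (lr_patterns I m u v (\<lambda>_. 0)) else 0)"
    by (intro sum.cong) auto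
  moreover have "(\<lambda>_. 0) \<in> box m S" by (simp add: box_def)
  ultimately show ?case using lr_patterns_zero_shape[of I u m v] Nil.prems(2) by (simp add: finite_box)
next
  case (Cons a as)
  let ?P = "chain_count UNIV m S (rev as) (\<lambda>_. 0)"
  have IH: "chain_count I m S as u' v = (\<Sum>p \<in> box m S. card (lr_patterns I m u' v p) * ?P p)"
    if "u' \<in> {u' \<in> box m S. strip I m a u u'}" for u'
  proof (rule Cons.IH)
    fix k assume "k \<in> I"
    then show "u' (Suc k) \<le> u' k"
      using that by (auto simp: strip_def hstrip_def intro: le_trans)
  qed (use that in simp)
  have "chain_count I m S (a # as) u v = (\<Sum>u' \<in> {u' \<in> box m S. strip I m a u u'}. chain_count I m S as u' v)"
    by (simp add: sum_of_bool_box)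
  also have "\<dots> = (\<Sum>u' \<in> {u' \<in> box m S. strip I m a u u'}. \<Sum>p \<in> box m S. card (lr_patterns I m u' v p) * ?P p)"
    by (intro sum.cong IH) auto
  also have "\<dots> = (\<Sum>p \<in> box m S.
      (\<Sum>u' \<in> {u' \<in> box m S. strip I m a u u'}. card (lr_patterns I m u' v p)) * ?P p)"
    by (subst sum.swap) (simp add: sum_distrib_right)
  also have "\<dots> = (\<Sum>p \<in> box m S.
      (\<Sum>q \<in> box m S. of_bool (strip UNIV m a p q) * card (lr_patterns I m u v q)) * ?P p)"
    by (simp add: lr_patterns_pieri[OF Cons.prems(1) assms(2,3)] sum_of_bool_box)
  also have "\<dots> = (\<Sum>q \<in> box m S. card (lr_patterns I m u v q) *
      (\<Sum>p \<in> box m S. ?P p * of_bool (strip UNIV m a p q)))"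
    unfolding sum_distrib_right sum_distrib_left by (subst sum.swap) (simp add: mult_ac)
  also have "\<dots> = (\<Sum>q \<in> box m S. card (lr_patterns I m u v q) * chain_count UNIV m S (rev (a # as)) (\<lambda>_. 0) q)"
    by (intro sum.cong refl) (simp add: chain_count_snoc box_def)
  finally show ?case .
qed

section \<open>Symmetry of Schur functions\<close>

text \<open>
  The Bender-Knuth involution on the middle partition \<open>v\<close> of a chain from \<open>u\<close> to \<open>w\<close>: each part is
  reflected in the interval allowed by \<open>u\<close> and \<open>w\<close>. In row \<open>0\<close> only \<open>w 0\<close> bounds the part from above.
\<close>
definition toggle :: "(nat \<Rightarrow> nat) \<Rightarrow> (nat \<Rightarrow> nat) \<Rightarrow> (nat \<Rightarrow> nat) \<Rightarrow> nat \<Rightarrow> nat" where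
  "toggle u w v i = (case i of 0 \<Rightarrow> max (u 0) (w (Suc 0)) + w 0 - v 0
     | Suc k \<Rightarrow> max (u (Suc k)) (w (Suc (Suc k))) + min (u k) (w (Suc k)) - v (Suc k))"

lemma toggle_hstrip:
  assumes "hstrip UNIV u v" "hstrip UNIV v w"
  shows "hstrip UNIV u (toggle u w v)" "hstrip UNIV (toggle u w v) w" "toggle u w (toggle u w v) = v"
    "sum (toggle u w v) {..<Suc j} + sum v {..<Suc j} =
      sum u {..<Suc j} + sum w {..<Suc j} + w (Suc j) - min (u j) (w (Suc j))"
proof -
  let ?t = "toggle u w v"
  have b: "u i \<le> v i" "v (Suc i) \<le> u i" "v i \<le> w i" "w (Suc i) \<le> v i" for i
    using assms by (auto simp: hstrip_UNIV)
  have t0: "?t 0 + v 0 = max (u 0) (w (Suc 0)) + w 0"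
    using b[of 0] by (simp add: toggle_def)
  have tS: "?t (Suc k) + v (Suc k) = max (u (Suc k)) (w (Suc (Suc k))) + min (u k) (w (Suc k))" for k
    using b[of k] b[of "Suc k"] by (simp add: toggle_def)
  have t: "u i \<le> ?t i \<and> ?t i \<le> w i \<and> w (Suc i) \<le> ?t i" for i
  proof (cases i)
    case 0 then show ?thesis using t0 b[of 0] unfolding 0 by linarith
  next
    case (Suc k) then show ?thesis using tS[of k] b[of k] b[of "Suc k"] unfolding Suc by linarith
  qed
  moreover have "?t (Suc i) \<le> u i" for i
    using tS[of i] b[of i] b[of "Suc i"] by linarith
  ultimately show h: "hstrip UNIV u ?t" "hstrip UNIV ?t w" by (auto simp: hstrip_UNIV)
  show "toggle u w ?t = v"
  proof
    fix i show "toggle u w ?t i = v i"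
    proof (cases i)
      case 0 then show ?thesis using t0 by (simp add: toggle_def[of u w ?t])
    next
      case (Suc k) then show ?thesis using tS[of k] by (simp add: toggle_def[of u w ?t])
    qed
  qed
  have "sum ?t {..<Suc j} + sum v {..<Suc j} + min (u j) (w (Suc j)) =
      sum u {..<Suc j} + sum w {..<Suc j} + w (Suc j)"
  proof (induction j)
    case 0
    have "?t 0 + v 0 + min (u 0) (w (Suc 0)) = u 0 + w 0 + w (Suc 0)" using t0 by linarith
    then show ?case by simp
  next
    case (Suc j)
    then show ?case
      using tS[of j] unfolding sum.lessThan_Suc[where n = "Suc j"] by linarith
  qed
  then show "sum ?t {..<Suc j} + sum v {..<Suc j} =
      sum u {..<Suc j} + sum w {..<Suc j} + w (Suc j) - min (u j) (w (Suc j))" by linarith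
qed

text \<open>
  Summed over all rows, the interval ends telescope to \<open>u + w\<close>, so the toggle exchanges the sizes of
  the two strips.
\<close>
lemma toggle_sum:
  assumes "hstrip UNIV u v" "hstrip UNIV v w" "w m = 0"
  shows "sum (toggle u w v) {..<m} + sum v {..<m} = sum u {..<m} + sum w {..<m}"
  using toggle_hstrip(4)[OF assms(1,2)] assms(3) by (cases m) simp_all

lemma strips_commute:
  assumes w: "w \<in> box m S"
  shows "(\<Sum>v \<in> box m S. of_bool (strip UNIV m a u v) * of_bool (strip UNIV m b v w) :: nat) =
    (\<Sum>v \<in> box m S. of_bool (strip UNIV m b u v) * of_bool (strip UNIV m a v w))"
proof -
  define X where "X a b = {v. strip UNIV m a u v \<and> strip UNIV m b v w}" for a b
  have X: "X a b \<subseteq> box m S" for a b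
  proof
    fix v assume "v \<in> X a b"
    then have "v i \<le> w i" for i by (auto simp: X_def strip_def hstrip_def)
    then show "v \<in> box m S" by (rule box_downward[OF w])
  qed
  have sumX: "(\<Sum>v \<in> box m S. of_bool (strip UNIV m a u v) * of_bool (strip UNIV m b v w)) = card (X a b)" for a b
  proof -
    have "(\<Sum>v \<in> box m S. of_bool (strip UNIV m a u v) * of_bool (strip UNIV m b v w)) =
        (\<Sum>v \<in> box m S. if v \<in> X a b then 1 else (0::nat))"
      by (intro sum.cong) (auto simp: X_def)
    also have "\<dots> = card (X a b)"
      using X[of a b] by (simp add: finite_box flip: sum.inter_filter) (simp add: Collect_conj_eq Int_absorb1)
    finally show ?thesis .
  qed
  have wm: "w m = 0" using w by (simp add: box_def)
  have T: "toggle u w v \<in> X b a" "toggle u w (toggle u w v) = v" if "v \<in> X a b" for a b v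
  proof -
    have v: "hstrip UNIV u v" "hstrip UNIV v w" "sum v {..<m} = sum u {..<m} + a" "sum w {..<m} = sum v {..<m} + b"
      using that by (auto simp: X_def strip_def)
    show "toggle u w (toggle u w v) = v" by (rule toggle_hstrip(3)[OF v(1,2)])
    show "toggle u w v \<in> X b a"
      using toggle_hstrip(1,2)[OF v(1,2)] toggle_sum[OF v(1,2) wm] v(3,4) by (auto simp: X_def strip_def)
  qed
  have "bij_betw (toggle u w) (X a b) (X b a)"
    by (rule bij_betw_byWitness[where f' = "toggle u w"]) (use T in auto)
  then show ?thesis unfolding sumX by (rule bij_betw_same_card)
qed

lemma chain_count_swap:
  assumes "w \<in> box m S"
  shows "chain_count UNIV m S (a # b # as) u w = chain_count UNIV m S (b # a # as) u w"
proof -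
  have E: "chain_count UNIV m S (a # b # as) u w = (\<Sum>x \<in> box m S.
      (\<Sum>v \<in> box m S. of_bool (strip UNIV m a u v) * of_bool (strip UNIV m b v x)) * chain_count UNIV m S as x w)" for a b
  proof -
    have "chain_count UNIV m S (a # b # as) u w = (\<Sum>v \<in> box m S. \<Sum>x \<in> box m S.
      of_bool (strip UNIV m a u v) * of_bool (strip UNIV m b v x) * chain_count UNIV m S as x w)"
      by (simp add: sum_distrib_left mult.assoc)
    then show ?thesis by (subst (asm) sum.swap) (simp add: sum_distrib_right)
  qed
  show ?thesis unfolding E by (intro sum.cong refl) (simp only: strips_commute)
qed

lemma chain_count_move:
  assumes "w \<in> box m S"
  shows "chain_count UNIV m S (as @ a # bs) u w = chain_count UNIV m S (a # as @ bs) u w"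
proof (induction as arbitrary: u)
  case (Cons c as)
  have "chain_count UNIV m S ((c # as) @ a # bs) u w = chain_count UNIV m S (c # a # as @ bs) u w"
    using Cons by simp
  then show ?case using chain_count_swap[OF assms] by simp
qed simp

lemma chain_count_mset_cong:
  assumes "mset as = mset bs" "w \<in> box m S"
  shows "chain_count UNIV m S as u w = chain_count UNIV m S bs u w"
  using assms(1)
proof (induction as arbitrary: bs u)
  case (Cons a as)
  then have "a \<in> set bs" by (metis list.set_intros(1) set_mset_mset)
  then obtain xs ys where bs: "bs = xs @ a # ys" by (meson split_list)
  then have "mset as = mset (xs @ ys)" using Cons.prems by simp
  then have "chain_count UNIV m S (a # as) u w = chain_count UNIV m S (a # xs @ ys) u w"
    using Cons.IH[of "xs @ ys"] by simp
  then show ?case using bs chain_count_move[OF assms(2)] by simp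
qed simp

section \<open>Tableaux as chains of horizontal strips\<close>

definition tableaux :: "nat set \<Rightarrow> (nat \<Rightarrow> nat) \<Rightarrow> (nat \<Rightarrow> nat) \<Rightarrow> (nat \<times> nat \<Rightarrow> nat) set" where
  "tableaux I la \<mu> = {T \<in> skew_diagram la \<mu> \<rightarrow>\<^sub>E UNIV.
     (\<forall>i j. (i, j) \<in> skew_diagram la \<mu> \<longrightarrow> (i, j + 1) \<in> skew_diagram la \<mu> \<longrightarrow>
        T (i, j) \<le> T (i, j + 1)) \<and>
     (\<forall>i j. i \<in> I \<longrightarrow> (i, j) \<in> skew_diagram la \<mu> \<longrightarrow> (i + 1, j) \<in> skew_diagram la \<mu> \<longrightarrow>
        T (i, j) < T (i + 1, j))}"

lemma tableaux_UNIV: "tableaux UNIV la \<mu> = skew_SSYT la \<mu>"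
  by (simp add: tableaux_def skew_SSYT_def)

lemma skew_diagram_Sigma:
  assumes "w \<in> box m S"
  shows "skew_diagram w u = (SIGMA i : {..<m}. {u i..<w i})"
proof -
  have "i < m" if "j < w i" for i j using assms that by (cases "i < m") (auto simp: box_def)
  then show ?thesis by (auto simp: skew_diagram_def)
qed

lemma finite_skew_diagram: "w \<in> box m S \<Longrightarrow> finite (skew_diagram w u)"
  by (simp add: skew_diagram_Sigma)

lemma card_skew_diagram:
  assumes "w \<in> box m S" "\<And>i. u i \<le> w i"
  shows "card (skew_diagram w u) + sum u {..<m} = sum w {..<m}"
proof -
  have "card (skew_diagram w u) = (\<Sum>i<m. w i - u i)"
    using assms(1) by (simp add: skew_diagram_Sigma)
  then show ?thesis using assms(2) by (simp flip: sum.distrib)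
qed

lemma entry_in_content:
  assumes "finite (skew_diagram w u)" "c \<in> skew_diagram w u"
  shows "T c \<in># content w u T"
  using assms by (simp add: content_def)

lemma finite_tableaux_content:
  assumes "finite (skew_diagram w u)"
  shows "finite {T \<in> tableaux I w u. content w u T = M}"
proof (rule finite_subset)
  show "{T \<in> tableaux I w u. content w u T = M} \<subseteq> skew_diagram w u \<rightarrow>\<^sub>E set_mset M"
    using entry_in_content[OF assms] by (auto simp: tableaux_def PiE_iff extensional_def)
  show "finite (skew_diagram w u \<rightarrow>\<^sub>E set_mset M)"
    using assms by (intro finite_PiE) auto
qed

text \<open>
  The multiplicity of the largest entry \<open>N\<close> depends only on the number of cells of \<open>w/v\<close>, and those of
  the other entries depend only on the restriction to \<open>v/u\<close>.
\<close>
lemma content_split: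
  assumes fin: "finite (skew_diagram w u)" and v: "\<And>i. u i \<le> v i" "\<And>i. v i \<le> w i"
    and lt: "\<And>c. c \<in> skew_diagram v u \<Longrightarrow> T c < N"
    and eq: "\<And>c. c \<in> skew_diagram w v \<Longrightarrow> T c = N"
    and M: "set_mset M \<subseteq> {..<Suc N}"
  shows "content w u T = M \<longleftrightarrow>
    content v u T = filter_mset (\<lambda>x. x < N) M \<and> card (skew_diagram w v) = count M N"
proof -
  have D: "skew_diagram w u = skew_diagram v u \<union> skew_diagram w v"
      "skew_diagram v u \<inter> skew_diagram w v = {}"
    using v by (auto simp: skew_diagram_def intro: le_trans less_le_trans)
  have fins: "finite (skew_diagram v u)" "finite (skew_diagram w v)" using fin D(1) by auto
  have "image_mset T (mset_set (skew_diagram w v)) = image_mset (\<lambda>_. N) (mset_set (skew_diagram w v))"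
    using fins eq by (intro image_mset_cong) auto
  then have c: "content w u T = content v u T + replicate_mset (card (skew_diagram w v)) N"
    unfolding content_def D(1) using D(2) fins by (simp add: mset_set_Union image_mset_const_eq)
  have less: "x < N" if "x \<in># content v u T" for x
    using that lt fins by (auto simp: content_def)
  have split: "M = filter_mset (\<lambda>x. x < N) M + replicate_mset (count M N) N"
  proof (rule multiset_eqI)
    fix x
    show "count M x = count (filter_mset (\<lambda>x. x < N) M + replicate_mset (count M N) N) x"
    proof (cases "x < N \<or> x = N")
      case False
      then have "x \<notin># M" using M by auto
      then show ?thesis using False by (auto simp: not_in_iff)
    qed auto
  qed
  show ?thesis
  proof
    assume "content w u T = M"
    then have M': "M = content v u T + replicate_mset (card (skew_diagram w v)) N" using c by simp
    have "filter_mset (\<lambda>x. x < N) (content v u T) = content v u T"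
      using less by (simp add: filter_mset_eq_conv)
    moreover have "count (content v u T) N = 0" using less by (auto simp: not_in_iff[symmetric])
    moreover have "filter_mset (\<lambda>x. x < N) (replicate_mset k N) = {#}" for k
      by (induction k) auto
    ultimately show "content v u T = filter_mset (\<lambda>x. x < N) M \<and> card (skew_diagram w v) = count M N"
      unfolding M' by simp
  next
    assume "content v u T = filter_mset (\<lambda>x. x < N) M \<and> card (skew_diagram w v) = count M N"
    then show "content w u T = M" using c split by simp
  qed
qed

text \<open>
  Used for the cells of one row: weakly increasing rows have their small entries on the left.
\<close>
lemma threshold_exists:
  assumes "a \<le> b" and "\<And>j. a \<le> j \<Longrightarrow> Suc j < b \<Longrightarrow> P (Suc j) \<Longrightarrow> P j"
  shows "\<exists>c::nat. a \<le> c \<and> c \<le> b \<and> (\<forall>j. a \<le> j \<longrightarrow> j < b \<longrightarrow> (P j \<longleftrightarrow> j < c))"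
  using assms
proof (induction b rule: dec_induct)
  case base
  then show ?case by auto
next
  case (step b)
  have "\<exists>c. a \<le> c \<and> c \<le> b \<and> (\<forall>j. a \<le> j \<longrightarrow> j < b \<longrightarrow> (P j \<longleftrightarrow> j < c))"
    by (rule step.IH) (use step.prems in auto)
  then obtain c where c: "a \<le> c" "c \<le> b" "\<And>j. a \<le> j \<Longrightarrow> j < b \<Longrightarrow> P j \<longleftrightarrow> j < c" by blast
  show ?case
  proof (cases "c = b \<and> P b")
    case True
    then show ?thesis using c step.hyps by (intro exI[of _ "Suc b"]) (auto simp: less_Suc_eq)
  next
    case False
    have "\<not> P b"
    proof
      assume Pb: "P b"
      then have "c < b" using False c(2) by auto
      then obtain d where d: "b = Suc d" "c \<le> d" by (cases b) auto
      have "P d" using step.prems[of d] Pb d c(1) by auto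
      then show False using c(3)[of d] c(1) d by auto
    qed
    then show ?thesis using c step.hyps by (intro exI[of _ c]) (auto simp: less_Suc_eq)
  qed
qed

text \<open>
  A tableau is determined by the cells \<open>w/v\<close> of its largest entry \<open>N\<close> and by its restriction to \<open>v/u\<close>.
  Column strictness for \<open>N\<close> means that two vertically adjacent cells of the same block are not both in
  \<open>w/v\<close>, which is the horizontal strip condition.
\<close>
lemma card_tableaux_peel:
  assumes w: "w \<in> box m S" "\<And>k. k \<in> I \<Longrightarrow> w (Suc k) \<le> w k"
    and u: "\<And>i. u i \<le> w i" "\<And>k. k \<in> I \<Longrightarrow> u (Suc k) \<le> u k"
    and M: "set_mset M \<subseteq> {..<Suc N}"
  shows "card {T \<in> tableaux I w u. content w u T = M} =
    (\<Sum>v \<in> {v \<in> box m S. strip I m (count M N) v w \<and> (\<forall>i. u i \<le> v i)}.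
      card {T \<in> tableaux I v u. content v u T = filter_mset (\<lambda>x. x < N) M})"
proof -
  let ?M' = "filter_mset (\<lambda>x. x < N) M"
  define V where "V = {v \<in> box m S. strip I m (count M N) v w \<and> (\<forall>i. u i \<le> v i)}"
  define A where "A = {T \<in> tableaux I w u. content w u T = M}"
  define B where "B v = {T \<in> tableaux I v u. content v u T = ?M'}" for v
  define thr where "thr T v \<longleftrightarrow>
    (\<forall>i j. (i, j) \<in> skew_diagram w u \<longrightarrow> (T (i, j) < N \<longleftrightarrow> j < v i))" for T :: "nat \<times> nat \<Rightarrow> nat" and v
  define R where "R T = (\<lambda>(v, T'). T' = restrict T (skew_diagram v u) \<and> thr T v)" for T
  note fin = finite_skew_diagram[OF w(1)]
  have le: "v i \<le> w i" if "v \<in> V" for v i using that by (auto simp: V_def strip_def hstrip_def)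
  have sub: "(i, j) \<in> skew_diagram v u \<Longrightarrow> (i, j) \<in> skew_diagram w u \<and> j < v i"
    if "\<And>i. v i \<le> w i" for v i j
    using that[of i] by (auto simp: skew_diagram_def)
  have cardV: "card (skew_diagram w v) = count M N \<longleftrightarrow> sum w {..<m} = sum v {..<m} + count M N"
    if "\<And>i. v i \<le> w i" for v
    using card_skew_diagram[OF w(1) that] by auto
  have bound: "T c \<le> N" if "T \<in> A" "c \<in> skew_diagram w u" for T c
    using entry_in_content[OF fin that(2), of T] that(1) M by (auto simp: A_def)
  have split: "content w u T = M \<longleftrightarrow> content v u T = ?M' \<and> sum w {..<m} = sum v {..<m} + count M N"
    if "thr T v" "\<And>i. u i \<le> v i" "\<And>i. v i \<le> w i" "\<And>c. c \<in> skew_diagram w u \<Longrightarrow> T c \<le> N" for T v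
    unfolding cardV[OF that(3), symmetric]
  proof (rule content_split[OF fin that(2,3) _ _ M])
    fix c assume "c \<in> skew_diagram v u"
    then show "T c < N" using that(1) sub[OF that(3)] by (cases c) (auto simp: thr_def)
  next
    fix c assume c: "c \<in> skew_diagram w v"
    obtain i j where ij: "c = (i, j)" by (cases c)
    have "(i, j) \<in> skew_diagram w u" "\<not> j < v i"
      using c that(2)[of i] ij by (auto simp: skew_diagram_def)
    then show "T c = N" using that(1) that(4)[of c] ij unfolding thr_def by (metis le_neq_implies_less)
  qed
  have content_restrict: "content v u (restrict T (skew_diagram v u)) = content v u T"
    if "\<And>i. v i \<le> w i" for v T
  proof -
    have "finite (skew_diagram v u)" using sub[OF that] by (intro finite_subset[OF _ fin]) auto
    then show ?thesis unfolding content_def by (intro image_mset_cong) auto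
  qed
  have "card A = card (Sigma V B)"
  proof (rule card_eq_by_relation[where R = R])
    fix T assume T: "T \<in> A"
    then have row: "T (i, j) \<le> T (i, Suc j)"
      if "(i, j) \<in> skew_diagram w u" "(i, Suc j) \<in> skew_diagram w u" for i j
      using that by (auto simp: A_def tableaux_def)
    have "\<exists>c. u i \<le> c \<and> c \<le> w i \<and> (\<forall>j. u i \<le> j \<longrightarrow> j < w i \<longrightarrow> (T (i, j) < N \<longleftrightarrow> j < c))" for i
    proof (rule threshold_exists[OF u(1)])
      fix j assume "u i \<le> j" "Suc j < w i" "T (i, Suc j) < N"
      then show "T (i, j) < N" using row[of i j] by (auto simp: skew_diagram_def)
    qed
    then obtain v where v: "\<And>i. u i \<le> v i" "\<And>i. v i \<le> w i"
        "\<And>i j. u i \<le> j \<Longrightarrow> j < w i \<Longrightarrow> T (i, j) < N \<longleftrightarrow> j < v i"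
      by metis
    have t: "thr T v" using v(3) by (auto simp: thr_def skew_diagram_def)
    have vb: "v \<in> box m S" by (rule box_downward[OF w(1) v(2)])
    have c: "content v u T = ?M'" "sum w {..<m} = sum v {..<m} + count M N"
      using split[OF t v(1,2) bound[OF T]] T by (auto simp: A_def)
    have "w (Suc k) \<le> v k" if "k \<in> I" for k
    proof (rule ccontr)
      assume n: "\<not> w (Suc k) \<le> v k"
      then have D: "(k, v k) \<in> skew_diagram w u" "(Suc k, v k) \<in> skew_diagram w u"
        using v(1)[of k] u(2)[OF that] w(2)[OF that] by (auto simp: skew_diagram_def)
      then have "T (k, v k) < T (Suc k, v k)" using T that by (auto simp: A_def tableaux_def)
      then have "T (k, v k) < N" using bound[OF T D(2)] by simp
      then show False using t D(1) by (auto simp: thr_def)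
    qed
    then have "v \<in> V" using vb c(2) v by (auto simp: V_def strip_def hstrip_def)
    moreover have "restrict T (skew_diagram v u) \<in> B v"
      using T sub[OF v(2)] c(1) content_restrict[OF v(2)] by (auto simp: A_def B_def tableaux_def)
    ultimately show "\<exists>y \<in> Sigma V B. R T y" using t by (auto simp: R_def)
  next
    fix y assume "y \<in> Sigma V B"
    then obtain v T' where y: "y = (v, T')" and v: "v \<in> V" and T': "T' \<in> B v" by auto
    note vw = le[OF v]
    have uv: "\<And>i. u i \<le> v i" and h: "\<And>k. k \<in> I \<Longrightarrow> w (Suc k) \<le> v k"
      and s: "sum w {..<m} = sum v {..<m} + count M N"
      using v by (auto simp: V_def strip_def hstrip_def)
    \<comment> \<open>The inverse fills the strip with the new largest entry.\<close>
    define T where "T c = (if c \<in> skew_diagram w u then if snd c < v (fst c) then T' c else N else undefined)" for c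
    have fv: "finite (skew_diagram v u)" using sub[OF vw] by (intro finite_subset[OF _ fin]) auto
    have lt: "T' c < N" if "c \<in> skew_diagram v u" for c
      using entry_in_content[OF fv that, of T'] T' by (auto simp: B_def)
    have in_v: "(i, j) \<in> skew_diagram v u" if "(i, j) \<in> skew_diagram w u" "j < v i" for i j
      using that by (auto simp: skew_diagram_def)
    have row': "T' (i, j) \<le> T' (i, Suc j)"
      if "(i, j) \<in> skew_diagram v u" "(i, Suc j) \<in> skew_diagram v u" for i j
      using T' that by (auto simp: B_def tableaux_def)
    have col': "T' (i, j) < T' (Suc i, j)"
      if "i \<in> I" "(i, j) \<in> skew_diagram v u" "(Suc i, j) \<in> skew_diagram v u" for i j
      using T' that by (auto simp: B_def tableaux_def)
    have t: "thr T v" using lt in_v by (auto simp: thr_def T_def)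
    have "T (i, j) \<le> T (i, Suc j)"
      if D: "(i, j) \<in> skew_diagram w u" "(i, Suc j) \<in> skew_diagram w u" for i j
      using D row'[of i j] in_v[OF D(1)] in_v[OF D(2)] lt[of "(i, j)"] by (auto simp: T_def)
    moreover have "T (i, j) < T (Suc i, j)"
      if i: "i \<in> I" and D: "(i, j) \<in> skew_diagram w u" "(Suc i, j) \<in> skew_diagram w u" for i j
    proof -
      have "j < v i" using D(2) h[OF i] by (auto simp: skew_diagram_def)
      then show ?thesis
        using D col'[OF i, of j] in_v[OF D(1)] in_v[OF D(2)] lt[of "(i, j)"] by (auto simp: T_def)
    qed
    ultimately have "T \<in> tableaux I w u" by (auto simp: tableaux_def T_def PiE_iff extensional_def)
    moreover have r: "restrict T (skew_diagram v u) = T'"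
    proof
      fix c show "restrict T (skew_diagram v u) c = T' c"
        using T' sub[OF vw] by (cases c) (auto simp: T_def B_def tableaux_def PiE_iff extensional_def)
    qed
    moreover have "content w u T = M"
    proof -
      have "T c \<le> N" if "c \<in> skew_diagram w u" for c
        using that lt[of c] in_v[of "fst c" "snd c"] by (auto simp: T_def)
      moreover have "content v u T = ?M'"
        using content_restrict[OF vw, of T] r T' by (simp add: B_def)
      ultimately show ?thesis using split[OF t uv vw] s by blast
    qed
    ultimately show "\<exists>T \<in> A. R T y" using t y by (auto simp: A_def R_def)
  next
    fix T y y' assume H: "T \<in> A" "y \<in> Sigma V B" "y' \<in> Sigma V B" "R T y" "R T y'"
    then obtain v v' where y: "y = (v, restrict T (skew_diagram v u))" "thr T v" "v \<in> V"
        "y' = (v', restrict T (skew_diagram v' u))" "thr T v'" "v' \<in> V"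
      by (auto simp: R_def)
    have le': "v i \<le> v' i" if "thr T v" "v \<in> V" "thr T v'" "v' \<in> V" for v v' i
    proof (rule ccontr)
      assume "\<not> v i \<le> v' i"
      then have "(i, v' i) \<in> skew_diagram w u" "v' i < v i"
        using that(4) le[OF that(2), of i] by (auto simp: V_def skew_diagram_def)
      then show False using that(1,3) unfolding thr_def by blast
    qed
    have "v = v'"
    proof
      fix i show "v i = v' i"
        using le'[OF y(2,3,5,6), of i] le'[OF y(5,6,2,3), of i] by simp
    qed
    then show "y = y'" using y by simp
  next
    fix T1 T2 y assume H: "T1 \<in> A" "T2 \<in> A" "y \<in> Sigma V B" "R T1 y" "R T2 y"
    then obtain v where v: "restrict T1 (skew_diagram v u) = restrict T2 (skew_diagram v u)"
        "thr T1 v" "thr T2 v" "v \<in> V"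
      by (auto simp: R_def)
    show "T1 = T2"
    proof
      fix c :: "nat \<times> nat"
      obtain i j where c: "c = (i, j)" by (cases c)
      show "T1 c = T2 c"
      proof (cases "c \<in> skew_diagram w u")
        case True
        show ?thesis
        proof (cases "j < v i")
          case l: True
          then have "c \<in> skew_diagram v u" using True c by (auto simp: skew_diagram_def)
          then show ?thesis using fun_cong[OF v(1), of c] by simp
        next
          case False
          then have "\<not> T1 c < N" "\<not> T2 c < N" using True c v(2,3) by (auto simp: thr_def)
          then show ?thesis using bound[OF H(1) True] bound[OF H(2) True] by simp
        qed
      next
        case False
        then show ?thesis
          using H(1,2) unfolding c by (auto simp: A_def tableaux_def PiE_iff extensional_def)
      qed
    qed
  qed
  moreover have "card (Sigma V B) = (\<Sum>v \<in> V. card (B v))"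
  proof (rule card_SigmaI)
    show "finite V" unfolding V_def using finite_box by simp
    show "\<forall>v \<in> V. finite (B v)"
      unfolding B_def V_def using finite_tableaux_content finite_skew_diagram by blast
  qed
  ultimately show ?thesis by (simp add: A_def B_def V_def)
qed

lemma card_tableaux_eq_chain_count:
  assumes u: "u \<in> box m S" "\<And>k. k \<in> I \<Longrightarrow> u (Suc k) \<le> u k"
    and "w \<in> box m S" "\<And>k. k \<in> I \<Longrightarrow> w (Suc k) \<le> w k" "\<And>i. u i \<le> w i"
    and "set_mset M \<subseteq> {..<N}"
  shows "card {T \<in> tableaux I w u. content w u T = M} = chain_count I m S (map (count M) [0..<N]) u w"
  using assms(3-6)
proof (induction N arbitrary: w M)
  case 0
  then have M: "M = {#}" by simp
  have c: "content w u T = M \<longleftrightarrow> skew_diagram w u = {}" for T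
    using finite_skew_diagram[OF 0(1), of u] by (simp add: content_def M mset_set_empty_iff)
  have d: "skew_diagram w u = {} \<longleftrightarrow> u = w"
  proof
    assume e: "skew_diagram w u = {}"
    have "u i = w i" for i
    proof (rule ccontr)
      assume "u i \<noteq> w i"
      then have "(i, u i) \<in> skew_diagram w u" using 0(3)[of i] by (simp add: skew_diagram_def)
      then show False using e by simp
    qed
    then show "u = w" by auto
  qed (auto simp: skew_diagram_def)
  show ?case
  proof (cases "u = w")
    case True
    then have "{T \<in> tableaux I w u. content w u T = M} = {\<lambda>_. undefined}"
      using c d by (auto simp: tableaux_def)
    then show ?thesis using True by simp
  qed (use c d in simp)
next
  case (Suc N)
  let ?as = "map (count M) [0..<N]" and ?M' = "filter_mset (\<lambda>x. x < N) M"
  have as: "?as = map (count ?M') [0..<N]" by simp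
  define V where "V = {v \<in> box m S. strip I m (count M N) v w \<and> (\<forall>i. u i \<le> v i)}"
  have "chain_count I m S (map (count M) [0..<Suc N]) u w =
      (\<Sum>v \<in> box m S. chain_count I m S ?as u v * of_bool (strip I m (count M N) v w))"
    using chain_count_snoc[OF u(1) Suc.prems(1)] by simp
  also have "\<dots> = (\<Sum>v \<in> V. chain_count I m S ?as u v * of_bool (strip I m (count M N) v w))"
  proof (rule sum.mono_neutral_right)
    show "\<forall>v \<in> box m S - V. chain_count I m S ?as u v * of_bool (strip I m (count M N) v w) = 0"
      using chain_count_le[of I m S ?as u] by (auto simp: V_def)
  qed (auto simp: V_def finite_box)
  also have "\<dots> = (\<Sum>v \<in> V. card {T \<in> tableaux I v u. content v u T = ?M'})"
  proof (rule sum.cong[OF refl])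
    fix v assume v: "v \<in> V"
    have "card {T \<in> tableaux I v u. content v u T = ?M'} = chain_count I m S ?as u v"
      unfolding as
    proof (rule Suc.IH)
      fix k assume k: "k \<in> I"
      have "v (Suc k) \<le> w (Suc k)" "w (Suc k) \<le> v k"
        using v k by (auto simp: V_def strip_def hstrip_def)
      then show "v (Suc k) \<le> v k" by simp
    qed (use v in \<open>auto simp: V_def\<close>)
    then show "chain_count I m S ?as u v * of_bool (strip I m (count M N) v w) =
        card {T \<in> tableaux I v u. content v u T = ?M'}"
      using v by (simp add: V_def)
  qed
  also have "\<dots> = card {T \<in> tableaux I w u. content w u T = M}"
    unfolding V_def
    by (rule card_tableaux_peel[symmetric]) (use Suc.prems u in auto)
  finally show ?case by simp
qed

section \<open>The product of two skew Schur functions\<close>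

lemma partition_decreasing: "partition_of_length m p \<Longrightarrow> p (Suc k) \<le> p k"
  by (simp add: partition_of_length_def)

lemma partition_box:
  assumes "partition_of_length m p" "sum p {..<m} \<le> S"
  shows "p \<in> box m S"
proof -
  have "p i \<le> S" for i
  proof (cases "i < m")
    case True
    then have "p i \<le> sum p {..<m}" by (intro member_le_sum) auto
    then show ?thesis using assms(2) by simp
  next
    case False
    then show ?thesis using assms(1) by (simp add: partition_of_length_def)
  qed
  then show ?thesis using assms(1) by (auto simp: box_def partition_of_length_def)
qed

text \<open>
  Placing the second diagram \<open>n\<close> rows below the first one does not shift columns, so rows \<open>n - 1\<close> and
  \<open>n\<close> may have cells in a common column. Therefore the index \<open>n - 1\<close> is excluded from the column
  condition in what follows.
\<close>
lemma concat_skew_diagram: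
  assumes "\<And>i. i \<ge> n \<Longrightarrow> la i = 0"
  shows "skew_diagram (concat_seq n la \<nu>) (concat_seq n \<mu> \<rho>) =
    skew_diagram la \<mu> \<union> (\<lambda>(i, j). (i + n, j)) ` skew_diagram \<nu> \<rho>"
    and "skew_diagram la \<mu> \<inter> (\<lambda>(i, j). (i + n, j)) ` skew_diagram \<nu> \<rho> = {}"
proof -
  have la: "i < n" if "j < la i" for i j using assms[of i] that by (cases "i < n") auto
  show "skew_diagram (concat_seq n la \<nu>) (concat_seq n \<mu> \<rho>) =
    skew_diagram la \<mu> \<union> (\<lambda>(i, j). (i + n, j)) ` skew_diagram \<nu> \<rho>"
  proof (rule set_eqI)
    fix c :: "nat \<times> nat"
    obtain i j where c: "c = (i, j)" by (cases c)
    show "c \<in> skew_diagram (concat_seq n la \<nu>) (concat_seq n \<mu> \<rho>) \<longleftrightarrow>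
      c \<in> skew_diagram la \<mu> \<union> (\<lambda>(i, j). (i + n, j)) ` skew_diagram \<nu> \<rho>"
    proof (cases "i < n")
      case True then show ?thesis by (auto simp: c skew_diagram_def concat_seq_def)
    next
      case False
      then have "c \<in> (\<lambda>(i, j). (i + n, j)) ` skew_diagram \<nu> \<rho> \<longleftrightarrow> (i - n, j) \<in> skew_diagram \<nu> \<rho>"
        unfolding c by (force simp: image_iff)
      then show ?thesis using False la[of j i] by (auto simp: c skew_diagram_def concat_seq_def)
    qed
  qed
  show "skew_diagram la \<mu> \<inter> (\<lambda>(i, j). (i + n, j)) ` skew_diagram \<nu> \<rho> = {}"
  proof (rule equals0I)
    fix c assume "c \<in> skew_diagram la \<mu> \<inter> (\<lambda>(i, j). (i + n, j)) ` skew_diagram \<nu> \<rho>"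
    then obtain i j where "(i + n, j) \<in> skew_diagram la \<mu>" by auto
    then have "j < la (i + n)" by (simp add: skew_diagram_def)
    then show False using la[of j "i + n"] by simp
  qed
qed

lemma bij_betw_tableau_pairs:
  assumes la: "\<And>i. i \<ge> n \<Longrightarrow> la i = 0" and fin: "finite (skew_diagram la \<mu>)" "finite (skew_diagram \<nu> \<rho>)"
  shows "bij_betw (\<lambda>(T1, T2) (i, j). if i < n then T1 (i, j) else T2 (i - n, j))
    {(T1, T2). T1 \<in> skew_SSYT la \<mu> \<and> T2 \<in> skew_SSYT \<nu> \<rho> \<and> content la \<mu> T1 + content \<nu> \<rho> T2 = M}
    {T \<in> tableaux {k. Suc k \<noteq> n} (concat_seq n la \<nu>) (concat_seq n \<mu> \<rho>).
       content (concat_seq n la \<nu>) (concat_seq n \<mu> \<rho>) T = M}"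
    (is "bij_betw ?f ?P ?T")
proof -
  let ?L = "concat_seq n la \<nu>" and ?U = "concat_seq n \<mu> \<rho>"
  let ?g = "\<lambda>T. (\<lambda>(i, j). if i < n then T (i, j) else undefined, \<lambda>(i, j). T (i + n, j))"
  have Dun: "skew_diagram ?L ?U = skew_diagram la \<mu> \<union> (\<lambda>(i, j). (i + n, j)) ` skew_diagram \<nu> \<rho>"
    and Ddisj: "skew_diagram la \<mu> \<inter> (\<lambda>(i, j). (i + n, j)) ` skew_diagram \<nu> \<rho> = {}"
    by (rule concat_skew_diagram[where n = n], fact la)+
  have D1: "(i, j) \<in> skew_diagram ?L ?U \<longleftrightarrow> (i, j) \<in> skew_diagram la \<mu>" if "i < n" for i j
    using that by (simp add: skew_diagram_def concat_seq_def)
  have D2: "(i + n, j) \<in> skew_diagram ?L ?U \<longleftrightarrow> (i, j) \<in> skew_diagram \<nu> \<rho>" for i j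
    by (simp add: skew_diagram_def concat_seq_def)
  have D2': "(i, j) \<in> skew_diagram ?L ?U \<longleftrightarrow> (i - n, j) \<in> skew_diagram \<nu> \<rho>" if "n \<le> i" for i j
    using that by (simp add: skew_diagram_def concat_seq_def)
  have small: "i < n" if "(i, j) \<in> skew_diagram la \<mu>" for i j
    using la[of i] that by (cases "i < n") (auto simp: skew_diagram_def)
  have content: "content ?L ?U T = content la \<mu> (fst (?g T)) + content \<nu> \<rho> (snd (?g T))" for T :: "nat \<times> nat \<Rightarrow> nat"
  proof -
    have "image_mset T (mset_set (skew_diagram la \<mu>)) = image_mset (fst (?g T)) (mset_set (skew_diagram la \<mu>))"
      using fin small by (intro image_mset_cong) auto
    moreover have "mset_set ((\<lambda>(i, j). (i + n, j)) ` skew_diagram \<nu> \<rho>) =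
        image_mset (\<lambda>(i, j). (i + n, j)) (mset_set (skew_diagram \<nu> \<rho>))"
      by (rule image_mset_mset_set[symmetric]) (auto simp: inj_on_def)
    moreover have "image_mset (T \<circ> (\<lambda>(i, j). (i + n, j))) X = image_mset (snd (?g T)) X" for X
      by (intro image_mset_cong) auto
    ultimately show ?thesis
      unfolding content_def Dun
      using Ddisj fin by (simp add: mset_set_Union multiset.map_comp)
  qed
  show ?thesis
  proof (rule bij_betw_byWitness[where f' = ?g])
    show gf: "\<forall>p \<in> ?P. ?g (?f p) = p"
    proof
      fix p assume "p \<in> ?P"
      then obtain T1 T2 where T: "p = (T1, T2)" "T1 \<in> skew_SSYT la \<mu>" by auto
      have "T1 (i, j) = undefined" if "\<not> i < n" for i j
        using T small that by (auto simp: skew_SSYT_def PiE_iff extensional_def)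
      then show "?g (?f p) = p" unfolding T(1) by (auto simp: fun_eq_iff)
    qed
    show fg: "\<forall>T \<in> ?T. ?f (?g T) = T" by (auto simp: fun_eq_iff)
    show "?f ` ?P \<subseteq> ?T"
    proof (rule image_subsetI)
      fix p assume p: "p \<in> ?P"
      then obtain T1 T2 where T: "p = (T1, T2)" "T1 \<in> skew_SSYT la \<mu>" "T2 \<in> skew_SSYT \<nu> \<rho>"
        "content la \<mu> T1 + content \<nu> \<rho> T2 = M" by auto
      define F where "F = ?f p"
      have F1: "F (i, j) = T1 (i, j)" if "i < n" for i j using that T(1) by (simp add: F_def)
      have F2: "F (i, j) = T2 (i - n, j)" if "\<not> i < n" for i j using that T(1) by (simp add: F_def)
      have "F c = undefined" if "c \<notin> skew_diagram ?L ?U" for c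
      proof -
        obtain i j where c: "c = (i, j)" by (cases c)
        show ?thesis
        proof (cases "i < n")
          case True
          then have "c \<notin> skew_diagram la \<mu>" using that D1 c by simp
          then show ?thesis using T(2) F1[OF True] c by (simp add: skew_SSYT_def PiE_iff extensional_def)
        next
          case False
          then have "(i - n, j) \<notin> skew_diagram \<nu> \<rho>" using that D2'[of i j] c by simp
          then show ?thesis using T(3) F2[OF False] c by (simp add: skew_SSYT_def PiE_iff extensional_def)
        qed
      qed
      moreover have "F (i, j) \<le> F (i, j + 1)"
        if "(i, j) \<in> skew_diagram ?L ?U" "(i, j + 1) \<in> skew_diagram ?L ?U" for i j
        using that T D1[of i] D2'[of i] F1[of i] F2[of i] by (cases "i < n") (auto simp: skew_SSYT_def not_less)
      moreover have "F (i, j) < F (i + 1, j)"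
        if "Suc i \<noteq> n" "(i, j) \<in> skew_diagram ?L ?U" "(i + 1, j) \<in> skew_diagram ?L ?U" for i j
      proof (cases "i < n")
        case True
        then show ?thesis using that T D1[of i] D1[of "i + 1"] F1 by (auto simp: skew_SSYT_def)
      next
        case False
        then show ?thesis
          using that T D2'[of i] D2'[of "i + 1"] F2[of i] F2[of "i + 1"]
          by (auto simp: skew_SSYT_def not_less Suc_diff_le)
      qed
      ultimately have "F \<in> tableaux {k. Suc k \<noteq> n} ?L ?U"
        by (auto simp: tableaux_def PiE_iff extensional_def)
      moreover have "content ?L ?U F = M"
      proof -
        have g: "?g F = (T1, T2)" using gf[rule_format, OF p] unfolding F_def T(1) .
        show ?thesis unfolding content[of F] g using T(4) by simp
      qed
      ultimately show "?f p \<in> ?T" by (simp add: F_def)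
    qed
    show "?g ` ?T \<subseteq> ?P"
    proof (rule image_subsetI)
      fix T assume T: "T \<in> ?T"
      define T1 where "T1 = fst (?g T)"
      define T2 where "T2 = snd (?g T)"
      have row: "T (i, j) \<le> T (i, Suc j)"
        if "(i, j) \<in> skew_diagram ?L ?U" "(i, Suc j) \<in> skew_diagram ?L ?U" for i j
        using T that by (auto simp: tableaux_def)
      have col: "T (i, j) < T (Suc i, j)"
        if "Suc i \<noteq> n" "(i, j) \<in> skew_diagram ?L ?U" "(Suc i, j) \<in> skew_diagram ?L ?U" for i j
        using T that by (auto simp: tableaux_def)
      have und: "T (i, j) = undefined" if "(i, j) \<notin> skew_diagram ?L ?U" for i j
        using T that by (auto simp: tableaux_def PiE_iff extensional_def)
      have "T1 \<in> skew_SSYT la \<mu>"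
      proof -
        have "T1 (i, j) = undefined" if "(i, j) \<notin> skew_diagram la \<mu>" for i j
          using that und D1 by (auto simp: T1_def)
        moreover have "T1 (i, j) \<le> T1 (i, Suc j)"
          if "(i, j) \<in> skew_diagram la \<mu>" "(i, Suc j) \<in> skew_diagram la \<mu>" for i j
          using that row[of i j] D1 small by (auto simp: T1_def)
        moreover have "T1 (i, j) < T1 (Suc i, j)"
          if "(i, j) \<in> skew_diagram la \<mu>" "(Suc i, j) \<in> skew_diagram la \<mu>" for i j
        proof -
          have "i < n" "Suc i < n" using small that by auto
          then show ?thesis using that col[of i j] D1 by (auto simp: T1_def)
        qed
        ultimately show ?thesis by (auto simp: skew_SSYT_def PiE_iff extensional_def)
      qed
      moreover have "T2 \<in> skew_SSYT \<nu> \<rho>"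
      proof -
        have "T2 (i, j) = undefined" if "(i, j) \<notin> skew_diagram \<nu> \<rho>" for i j
          using that und D2 by (auto simp: T2_def)
        moreover have "T2 (i, j) \<le> T2 (i, Suc j)"
          if "(i, j) \<in> skew_diagram \<nu> \<rho>" "(i, Suc j) \<in> skew_diagram \<nu> \<rho>" for i j
          using that row[of "i + n" j] D2 by (auto simp: T2_def)
        moreover have "T2 (i, j) < T2 (Suc i, j)"
          if "(i, j) \<in> skew_diagram \<nu> \<rho>" "(Suc i, j) \<in> skew_diagram \<nu> \<rho>" for i j
          using that col[of "i + n" j] D2[of i j] D2[of "Suc i" j] by (auto simp: T2_def)
        ultimately show ?thesis by (auto simp: skew_SSYT_def PiE_iff extensional_def)
      qed
      moreover have "content la \<mu> T1 + content \<nu> \<rho> T2 = M"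
        using content[of T] T by (simp add: T1_def T2_def)
      ultimately show "?g T \<in> ?P" by (simp add: T1_def T2_def)
    qed
  qed
qed

lemma finite_submultisets: "finite {A. A \<subseteq># M}"
proof (induction M)
  case (add x M)
  have "A \<in> {A. A \<subseteq># M} \<union> add_mset x ` {A. A \<subseteq># M}" if "A \<subseteq># add_mset x M" for A
  proof (cases "x \<in># A")
    case True
    then have "A = add_mset x (A - {#x#})" "A - {#x#} \<subseteq># M"
      using that by (simp_all add: subset_eq_diff_conv)
    then show ?thesis by blast
  next
    case False
    then have "count A y \<le> count M y" for y
      using mset_subset_eq_count[OF that, of y] by (cases "y = x") (auto simp: not_in_iff)
    then show ?thesis by (simp add: subseteq_mset_def)
  qed
  then have "{A. A \<subseteq># add_mset x M} \<subseteq> {A. A \<subseteq># M} \<union> add_mset x ` {A. A \<subseteq># M}"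
    by (intro subsetI) (simp only: mem_Collect_eq)
  then show ?case by (rule finite_subset) (simp add: add)
qed simp

lemma finite_multiset_splittings: "finite {(A, B). A + B = (M :: 'a multiset)}"
proof (rule finite_subset)
  show "{(A, B). A + B = M} \<subseteq> {A. A \<subseteq># M} \<times> {A. A \<subseteq># M}" by auto
qed (simp add: finite_submultisets)

lemma concat_decreasing:
  assumes "partition_of_length n p" "partition_of_length n q" "Suc k \<noteq> n"
  shows "concat_seq n p q (Suc k) \<le> concat_seq n p q k"
  using assms partition_decreasing[of n p k] partition_decreasing[of n q "k - n"]
  by (auto simp: concat_seq_def Suc_diff_le)

lemma concat_box:
  assumes "partition_of_length n q" "sum (concat_seq n p q) {..<2 * n} \<le> S"
  shows "concat_seq n p q \<in> box (2 * n) S"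
proof -
  have 0: "concat_seq n p q i = 0" if "2 * n \<le> i" for i
    using that assms(1) by (auto simp: concat_seq_def partition_of_length_def)
  moreover have "concat_seq n p q i \<le> S" for i
  proof (cases "i < 2 * n")
    case True
    then have "concat_seq n p q i \<le> sum (concat_seq n p q) {..<2 * n}" by (intro member_le_sum) auto
    then show ?thesis using assms(2) by simp
  qed (simp add: 0)
  ultimately show ?thesis by (simp add: box_def)
qed

text \<open>
  If one of the skew shapes does not exist, then the product vanishes; and so does the number of
  chains, because a chain from \<open>u\<close> to \<open>v\<close> forces \<open>u \<le> v\<close>.
\<close>
lemma product_coefficient:
  assumes la: "partition_of_length n la" and \<mu>: "partition_of_length n \<mu>"
    and \<nu>: "partition_of_length n \<nu>" and \<rho>: "partition_of_length n \<rho>"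
    and S: "sum (concat_seq n la \<nu>) {..<2 * n} \<le> S" "sum (concat_seq n \<mu> \<rho>) {..<2 * n} \<le> S"
    and M: "set_mset M \<subseteq> {..<N}"
  shows "series_mult (skew_schur la \<mu>) (skew_schur \<nu> \<rho>) M =
    int (chain_count {k. Suc k \<noteq> n} (2 * n) S (map (count M) [0..<N]) (concat_seq n \<mu> \<rho>) (concat_seq n la \<nu>))"
proof -
  let ?L = "concat_seq n la \<nu>" and ?U = "concat_seq n \<mu> \<rho>" and ?I = "{k. Suc k \<noteq> n}"
  have L: "?L \<in> box (2 * n) S" by (rule concat_box[OF \<nu> S(1)])
  have U: "?U \<in> box (2 * n) S" by (rule concat_box[OF \<rho> S(2)])
  show ?thesis
  proof (cases "(\<forall>i. \<mu> i \<le> la i) \<and> (\<forall>i. \<rho> i \<le> \<nu> i)")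
    case True
    then have le: "?U i \<le> ?L i" for i by (simp add: concat_seq_def)
    have fin: "finite (skew_diagram la \<mu>)" "finite (skew_diagram \<nu> \<rho>)"
      using partition_box[OF la order_refl] partition_box[OF \<nu> order_refl] finite_skew_diagram by blast+
    have la0: "la i = 0" if "n \<le> i" for i using la that by (simp add: partition_of_length_def)
    define P where "P = {(T1, T2). T1 \<in> skew_SSYT la \<mu> \<and> T2 \<in> skew_SSYT \<nu> \<rho> \<and>
      content la \<mu> T1 + content \<nu> \<rho> T2 = M}"
    define Z where "Z = {(A, B). A + B = M}"
    define c where "c = (\<lambda>(T1, T2). (content la \<mu> T1, content \<nu> \<rho> T2))"
    note bij = bij_betw_tableau_pairs[OF la0 fin, where M = M, folded P_def]
    have finP: "finite P"
      using bij_betw_finite[OF bij] finite_tableaux_content[OF finite_skew_diagram[OF L]] by blast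
    have cP: "c ` P \<subseteq> Z" by (auto simp: P_def Z_def c_def)
    have finZ: "finite Z" unfolding Z_def by (rule finite_multiset_splittings)
    have "card P = (\<Sum>z \<in> Z. card {p \<in> P. c p = z})"
      using sum.group[OF finP finZ cP, of "\<lambda>_. 1 :: nat"] by simp
    also have "\<dots> = (\<Sum>(A, B) \<in> Z. card {T \<in> skew_SSYT la \<mu>. content la \<mu> T = A} *
        card {T \<in> skew_SSYT \<nu> \<rho>. content \<nu> \<rho> T = B})"
    proof (rule sum.cong[OF refl])
      fix z assume "z \<in> Z"
      then obtain A B where z: "z = (A, B)" "A + B = M" by (auto simp: Z_def)
      have "{p \<in> P. c p = z} =
          {T \<in> skew_SSYT la \<mu>. content la \<mu> T = A} \<times> {T \<in> skew_SSYT \<nu> \<rho>. content \<nu> \<rho> T = B}"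
        using z by (auto simp: P_def c_def)
      then show "card {p \<in> P. c p = z} = (case z of (A, B) \<Rightarrow>
          card {T \<in> skew_SSYT la \<mu>. content la \<mu> T = A} * card {T \<in> skew_SSYT \<nu> \<rho>. content \<nu> \<rho> T = B})"
        using z by (simp add: card_cartesian_product)
    qed
    finally have "series_mult (skew_schur la \<mu>) (skew_schur \<nu> \<rho>) M = int (card P)"
      using True by (simp add: series_mult_def skew_schur_def Z_def case_prod_beta)
    also have "card P = chain_count ?I (2 * n) S (map (count M) [0..<N]) ?U ?L"
      using bij_betw_same_card[OF bij] concat_decreasing[OF la \<nu>] concat_decreasing[OF \<mu> \<rho>]
        card_tableaux_eq_chain_count[OF U _ L _ le M, of ?I]
      by simp
    finally show ?thesis .
  next
    case False
    have "chain_count ?I (2 * n) S (map (count M) [0..<N]) ?U ?L = 0"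
    proof (rule ccontr)
      assume "chain_count ?I (2 * n) S (map (count M) [0..<N]) ?U ?L \<noteq> 0"
      then have le: "?U k \<le> ?L k" for k by (rule chain_count_le)
      have "\<mu> i \<le> la i" for i
        using le[of i] \<mu> by (cases "i < n") (simp_all add: concat_seq_def partition_of_length_def)
      moreover have "\<rho> i \<le> \<nu> i" for i using le[of "i + n"] by (simp add: concat_seq_def)
      ultimately show False using False by blast
    qed
    moreover have "skew_schur la \<mu> = (\<lambda>_. 0) \<or> skew_schur \<nu> \<rho> = (\<lambda>_. 0)"
      using False by (auto simp: skew_schur_def)
    then have "series_mult (skew_schur la \<mu>) (skew_schur \<nu> \<rho>) M = 0"
      by (auto simp: series_mult_def intro!: sum.neutral)
    ultimately show ?thesis by simp
  qed
qed

text \<open>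
  The list of strip sizes is reversed here, as allowed by the symmetry of Schur functions, in order to
  match \<open>chain_count_eq_sum_lr_patterns\<close>.
\<close>
lemma schur_coefficient:
  assumes "partition_of_length m p" "p \<in> box m S" "set_mset M \<subseteq> {..<N}"
  shows "schur p M = int (chain_count UNIV m S (rev (map (count M) [0..<N])) (\<lambda>_. 0) p)"
proof -
  have "card {T \<in> tableaux UNIV p (\<lambda>_. 0). content p (\<lambda>_. 0) T = M} =
      chain_count UNIV m S (map (count M) [0..<N]) (\<lambda>_. 0) p"
    by (rule card_tableaux_eq_chain_count) (use assms partition_decreasing in \<open>auto simp: box_def\<close>)
  also have "\<dots> = chain_count UNIV m S (rev (map (count M) [0..<N])) (\<lambda>_. 0) p"
    using assms(2) by (intro chain_count_mset_cong) simp_all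
  finally show ?thesis by (simp add: schur_def skew_schur_def tableaux_UNIV)
qed

lemma lr_patterns_partition:
  assumes "Q \<in> lr_patterns I m u v p"
  shows "partition_of_length m p"
proof -
  have g: "gt_pattern m Q" and p: "Q m = p" using assms by (auto simp: lr_patterns_def)
  have "Q (Suc m) = p" using gt_pattern_stable[OF g, of "Suc m"] p by simp
  then have "hstrip UNIV p p" using gt_pattern_step[OF g, of m] unfolding p by simp
  then have step: "p (Suc k) \<le> p k" for k by (simp add: hstrip_UNIV)
  have "p j \<le> p i" if "i \<le> j" for i j
    by (rule lift_Suc_antimono_le[of p, OF step that])
  moreover have "p i = 0" if "m \<le> i" for i using gt_pattern_rows[OF g that, of m] p by simp
  ultimately show ?thesis by (simp add: partition_of_length_def)
qed

definition lr_number :: "nat \<Rightarrow> (nat \<Rightarrow> nat) \<Rightarrow> (nat \<Rightarrow> nat) \<Rightarrow> (nat \<Rightarrow> nat) \<Rightarrow> (nat \<Rightarrow> nat) \<Rightarrow> (nat \<Rightarrow> nat) \<Rightarrow> nat" where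
  "lr_number n la \<mu> \<nu> \<rho> p =
     card (lr_patterns {k. Suc k \<noteq> n} (2 * n) (concat_seq n \<mu> \<rho>) (concat_seq n la \<nu>) p)"

lemma product_schur_expansion:
  assumes la: "partition_of_length n la" and \<mu>: "partition_of_length n \<mu>"
    and \<nu>: "partition_of_length n \<nu>" and \<rho>: "partition_of_length n \<rho>"
  shows "schur_expansion (series_mult (skew_schur la \<mu>) (skew_schur \<nu> \<rho>)) (\<lambda>p. int (lr_number n la \<mu> \<nu> \<rho> p))"
proof -
  let ?L = "concat_seq n la \<nu>" and ?U = "concat_seq n \<mu> \<rho>" and ?I = "{k. Suc k \<noteq> n}"
  define S where "S = sum ?L {..<2 * n} + sum ?U {..<2 * n}"
  let ?X = "box (2 * n) S"
  define c where "c p = int (lr_number n la \<mu> \<nu> \<rho> p)" for p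
  have nz: "p \<in> ?X \<and> partition_of_length (2 * n) p" if "c p \<noteq> 0" for p
  proof -
    have "lr_patterns ?I (2 * n) ?U ?L p \<noteq> {}" using that by (auto simp: c_def lr_number_def)
    then obtain Q where Q: "Q \<in> lr_patterns ?I (2 * n) ?U ?L p" by blast
    have "Q (2 * n) = p" using Q by (simp add: lr_patterns_def)
    then show ?thesis
      using lr_patterns_box[OF Q, of S "2 * n"] lr_patterns_partition[OF Q] by (simp add: S_def)
  qed
  have sub: "{p. c p \<noteq> 0} \<subseteq> ?X" using nz by blast
  have "series_mult (skew_schur la \<mu>) (skew_schur \<nu> \<rho>) M = (\<Sum>p \<in> {p. c p \<noteq> 0}. c p * schur p M)" for M
  proof -
    obtain N where N: "set_mset M \<subseteq> {..<N}"
      using finite_nat_set_iff_bounded[of "set_mset M"] by auto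
    let ?as = "map (count M) [0..<N]"
    have in_box: "?L \<in> ?X" "?U \<in> ?X"
      using concat_box[OF \<nu>, of la S] concat_box[OF \<rho>, of \<mu> S] by (simp_all add: S_def)
    have dec: "?U (Suc k) \<le> ?U k" if "k \<in> ?I" for k
      using concat_decreasing[OF \<mu> \<rho>] that by simp
    have "series_mult (skew_schur la \<mu>) (skew_schur \<nu> \<rho>) M = int (chain_count ?I (2 * n) S ?as ?U ?L)"
      by (rule product_coefficient[OF la \<mu> \<nu> \<rho> _ _ N]) (simp_all add: S_def)
    also have "\<dots> = (\<Sum>p \<in> ?X. c p * int (chain_count UNIV (2 * n) S (rev ?as) (\<lambda>_. 0) p))"
    proof -
      have "sum ?L {..<2 * n} \<le> S" by (simp add: S_def)
      then have "chain_count ?I (2 * n) S ?as ?U ?L = (\<Sum>p \<in> ?X. card (lr_patterns ?I (2 * n) ?U ?L p) *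
          chain_count UNIV (2 * n) S (rev ?as) (\<lambda>_. 0) p)"
        using chain_count_eq_sum_lr_patterns in_box dec by blast
      then show ?thesis by (simp add: c_def lr_number_def)
    qed
    also have "\<dots> = (\<Sum>p \<in> {p. c p \<noteq> 0}. c p * int (chain_count UNIV (2 * n) S (rev ?as) (\<lambda>_. 0) p))"
      by (rule sum.mono_neutral_right) (use sub finite_box in auto)
    also have "\<dots> = (\<Sum>p \<in> {p. c p \<noteq> 0}. c p * schur p M)"
    proof (rule sum.cong[OF refl])
      fix p assume "p \<in> {p. c p \<noteq> 0}"
      then have "p \<in> ?X" "partition_of_length (2 * n) p" using nz by auto
      then show "c p * int (chain_count UNIV (2 * n) S (rev ?as) (\<lambda>_. 0) p) = c p * schur p M"
        using schur_coefficient[OF _ _ N] by simp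
    qed
    finally show ?thesis .
  qed
  then show ?thesis
    unfolding schur_expansion_def c_def[symmetric]
    using nz finite_subset[OF sub finite_box] by (auto simp: partitions_def)
qed

section \<open>Uniqueness of Schur expansions\<close>

lemma partition_diagram_finite: "p \<in> partitions \<Longrightarrow> finite (skew_diagram p u)"
  using partition_box[OF _ order_refl] finite_skew_diagram by (fastforce simp: partitions_def)

text \<open>
  Going down a column of a straight shape from row \<open>0\<close>, the entries increase strictly.
\<close>
lemma straight_tableau_ge_row:
  assumes p: "p \<in> partitions" and T: "T \<in> skew_SSYT p (\<lambda>_. 0)"
  shows "(i, j) \<in> skew_diagram p (\<lambda>_. 0) \<Longrightarrow> i \<le> T (i, j)"
proof (induction i)
  case (Suc i)
  have "p (Suc i) \<le> p i" using p partition_decreasing by (auto simp: partitions_def)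
  then have "(i, j) \<in> skew_diagram p (\<lambda>_. 0)" using Suc.prems by (simp add: skew_diagram_def)
  moreover from this have "T (i, j) < T (i + 1, j)" using T Suc.prems by (simp add: skew_SSYT_def)
  ultimately show ?case using Suc.IH by simp
qed simp

lemma size_filter_content:
  assumes "finite (skew_diagram p u)"
  shows "size (filter_mset P (content p u T)) = card {c \<in> skew_diagram p u. P (T c)}"
  using assms by (simp add: content_def filter_mset_image_mset filter_mset_mset_set)

lemma card_first_rows: "card {c \<in> skew_diagram p (\<lambda>_. 0). fst c < k} = sum p {..<k}"
proof -
  have "{c \<in> skew_diagram p (\<lambda>_. 0). fst c < k} = (SIGMA i : {..<k}. {..<p i})"
    by (auto simp: skew_diagram_def)
  then show ?thesis by simp
qed

lemma small_entries_in_first_rows: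
  assumes "p \<in> partitions" "T \<in> skew_SSYT p (\<lambda>_. 0)"
  shows "{c \<in> skew_diagram p (\<lambda>_. 0). T c < k} \<subseteq> {c \<in> skew_diagram p (\<lambda>_. 0). fst c < k}"
proof
  fix c assume "c \<in> {c \<in> skew_diagram p (\<lambda>_. 0). T c < k}"
  then show "c \<in> {c \<in> skew_diagram p (\<lambda>_. 0). fst c < k}"
    using straight_tableau_ge_row[OF assms, of "fst c" "snd c"] by simp
qed

lemma card_small_entries:
  assumes "q \<in> partitions" "p \<in> partitions" "content p (\<lambda>_. 0) T = content q (\<lambda>_. 0) fst"
  shows "card {c \<in> skew_diagram p (\<lambda>_. 0). T c < k} = sum q {..<k}"
proof -
  have "card {c \<in> skew_diagram p (\<lambda>_. 0). T c < k} = size (filter_mset (\<lambda>x. x < k) (content p (\<lambda>_. 0) T))"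
    by (rule size_filter_content[OF partition_diagram_finite[OF assms(2)], where P = "\<lambda>x. x < k" and T = T, symmetric])
  also have "\<dots> = card {c \<in> skew_diagram q (\<lambda>_. 0). fst c < k}"
    unfolding assms(3) by (rule size_filter_content[OF partition_diagram_finite[OF assms(1)], where P = "\<lambda>x. x < k" and T = fst])
  also have "\<dots> = sum q {..<k}" by (rule card_first_rows)
  finally show ?thesis .
qed

text \<open>
  The monomial is the content of the tableau of shape \<open>q\<close> whose entries are the row indices. In a
  tableau of shape \<open>p\<close> with this content, the entries below \<open>k\<close> lie in the first \<open>k\<close> rows, and there are
  \<open>q 0 + \<dots> + q (k - 1)\<close> of them.
\<close>
lemma schur_dominance:
  assumes p: "p \<in> partitions" and q: "q \<in> partitions"
    and nz: "schur p (content q (\<lambda>_. 0) fst) \<noteq> 0"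
  shows "sum q {..<k} \<le> sum p {..<k}"
proof -
  obtain T where T: "T \<in> skew_SSYT p (\<lambda>_. 0)" "content p (\<lambda>_. 0) T = content q (\<lambda>_. 0) fst"
  proof -
    define X where "X = {T \<in> skew_SSYT p (\<lambda>_. 0). content p (\<lambda>_. 0) T = content q (\<lambda>_. 0) fst}"
    have "schur p (content q (\<lambda>_. 0) fst) = int (card X)"
      by (simp add: schur_def skew_schur_def X_def)
    then have "X \<noteq> {}" using nz by auto
    then show thesis using that unfolding X_def by blast
  qed
  have "sum q {..<k} = card {c \<in> skew_diagram p (\<lambda>_. 0). T c < k}"
    using card_small_entries[OF q p T(2)] by simp
  also have "\<dots> \<le> card {c \<in> skew_diagram p (\<lambda>_. 0). fst c < k}"
    using small_entries_in_first_rows[OF p T(1)] partition_diagram_finite[OF p]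
    by (intro card_mono) auto
  finally show ?thesis by (simp add: card_first_rows)
qed

text \<open>
  Here the first \<open>k\<close> rows are filled completely by the entries below \<open>k\<close>, for each \<open>k\<close>, which leaves only
  the tableau with the row indices as entries.
\<close>
lemma schur_own_monomial:
  assumes p: "p \<in> partitions"
  shows "schur p (content p (\<lambda>_. 0) fst) = 1"
proof -
  let ?D = "skew_diagram p (\<lambda>_. 0)"
  note fin = partition_diagram_finite[OF p]
  have "{T \<in> skew_SSYT p (\<lambda>_. 0). content p (\<lambda>_. 0) T = content p (\<lambda>_. 0) fst} = {restrict fst ?D}"
  proof (intro equalityI subsetI)
    fix T assume "T \<in> {T \<in> skew_SSYT p (\<lambda>_. 0). content p (\<lambda>_. 0) T = content p (\<lambda>_. 0) fst}"
    then have T: "T \<in> skew_SSYT p (\<lambda>_. 0)" "content p (\<lambda>_. 0) T = content p (\<lambda>_. 0) fst" by auto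
    have eq: "{c \<in> ?D. T c < k} = {c \<in> ?D. fst c < k}" for k
      using small_entries_in_first_rows[OF p T(1)] fin card_small_entries[OF p p T(2)] card_first_rows[of p k]
      by (intro card_subset_eq) auto
    have "T c = restrict fst ?D c" for c
    proof (cases "c \<in> ?D")
      case True
      then have "T c < Suc (fst c)" using eq[of "Suc (fst c)"] by blast
      moreover have "fst c \<le> T c" using straight_tableau_ge_row[OF p T(1), of "fst c" "snd c"] True by simp
      ultimately show ?thesis using True by simp
    next
      case False
      then show ?thesis using T(1) by (cases c) (auto simp: skew_SSYT_def PiE_iff extensional_def)
    qed
    then show "T \<in> {restrict fst ?D}" by auto
  next
    fix T assume "T \<in> {restrict fst ?D}"
    moreover have "restrict fst ?D \<in> skew_SSYT p (\<lambda>_. 0)"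
      by (auto simp: skew_SSYT_def)
    moreover have "content p (\<lambda>_. 0) (restrict fst ?D) = content p (\<lambda>_. 0) fst"
      unfolding content_def using fin by (intro image_mset_cong) auto
    ultimately show "T \<in> {T \<in> skew_SSYT p (\<lambda>_. 0). content p (\<lambda>_. 0) T = content p (\<lambda>_. 0) fst}" by simp
  qed
  then show ?thesis by (simp add: schur_def skew_schur_def)
qed

text \<open>
  Among the partitions at which the two expansions differ, take one, \<open>q\<close>, that is maximal in dominance
  order. At the monomial of \<open>q\<close>, all other terms of the difference vanish and that of \<open>q\<close> does not.
\<close>
lemma schur_expansion_unique:
  assumes c: "schur_expansion f c" and c': "schur_expansion f c'"
  shows "c = c'"
proof (rule ccontr)
  assume ne: "c \<noteq> c'"
  define F where "F = {p. c p \<noteq> 0} \<union> {p. c' p \<noteq> 0}"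
  define d where "d p = c p - c' p" for p
  define E where "E = {p. d p \<noteq> 0}"
  have F: "finite F" "F \<subseteq> partitions" using c c' by (auto simp: F_def schur_expansion_def)
  have E: "E \<subseteq> F" by (auto simp: E_def F_def d_def)
  have f: "f M = (\<Sum>p \<in> F. e p * schur p M)" if "schur_expansion f e" "{p. e p \<noteq> 0} \<subseteq> F" for e M
  proof -
    have "f M = (\<Sum>p \<in> {p. e p \<noteq> 0}. e p * schur p M)"
      using that(1) unfolding schur_expansion_def by (elim conjE) (rule fun_cong)
    also have "\<dots> = (\<Sum>p \<in> F. e p * schur p M)"
      by (rule sum.mono_neutral_left) (use F that(2) in auto)
    finally show ?thesis .
  qed
  have zero: "(\<Sum>p \<in> F. d p * schur p M) = 0" for M
    using f[OF c, of M] f[OF c', of M] by (simp add: F_def d_def left_diff_distrib sum_subtractf)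
  \<comment> \<open>Dominance order is the pointwise order of the partial sums.\<close>
  define pre where "pre p k = sum p {..<k}" for p :: "nat \<Rightarrow> nat" and k
  have inj: "p = q" if "pre p = pre q" for p q
  proof
    fix k
    have "pre p (Suc k) = pre q (Suc k)" "pre p k = pre q k" by (simp_all only: that)
    then show "p k = q k" by (simp add: pre_def)
  qed
  have "E \<noteq> {}" using ne by (auto simp: E_def d_def)
  then have "finite (pre ` E)" "pre ` E \<noteq> {}" using finite_subset[OF E F(1)] by auto
  then obtain g where g: "g \<in> pre ` E" "\<And>b. b \<in> pre ` E \<Longrightarrow> g \<le> b \<Longrightarrow> g = b"
    using finite_has_maximal[of "pre ` E"] by blast
  then obtain q where q: "q \<in> E" "g = pre q" by blast
  have qF: "q \<in> F" and qp: "q \<in> partitions" using q(1) E F(2) by auto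
  let ?M = "content q (\<lambda>_. 0) fst"
  have "d p * schur p ?M = 0" if p: "p \<in> F - {q}" for p
  proof (rule ccontr)
    assume "d p * schur p ?M \<noteq> 0"
    then have pE: "p \<in> E" and nz: "schur p ?M \<noteq> 0" by (auto simp: E_def)
    have "p \<in> partitions" using p F(2) by blast
    then have "pre q \<le> pre p"
      using schur_dominance[OF _ qp nz] by (simp add: le_fun_def pre_def)
    then have "pre q = pre p" using g(2)[of "pre p"] pE unfolding q(2) by blast
    then show False using inj[of q p] p by simp
  qed
  then have "(\<Sum>p \<in> F - {q}. d p * schur p ?M) = 0" by (rule sum.neutral[OF ballI])
  then have "(\<Sum>p \<in> F. d p * schur p ?M) = d q * schur q ?M"
    by (simp add: sum.remove[OF F(1) qF])
  then show False using zero[of ?M] schur_own_monomial[OF qp] q(1) by (simp add: E_def)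
qed

lemma schur_coeff_eq: "schur_expansion f c \<Longrightarrow> schur_coeff f = c"
  unfolding schur_coeff_def using schur_expansion_unique by (intro the_equality) auto

section \<open>Skew hives as Littlewood-Richardson patterns\<close>

lemma sum_zero_tail:
  fixes f :: "nat \<Rightarrow> nat"
  assumes "k \<le> l" "\<And>i. k \<le> i \<Longrightarrow> f i = 0"
  shows "sum f {..<l} = sum f {..<k}"
  by (rule sum.mono_neutral_right) (use assms in auto)

text \<open>
  The condition for rows \<open>j > k\<close> compares total contents and amounts to \<open>v (k + 1) \<le> v k\<close>, since the
  letters up to \<open>k + 1\<close> occur only in the rows up to \<open>k + 1\<close>. For \<open>k \<ge> m - 1\<close> there are no letters \<open>k + 1\<close>.
  What remains is one inequality for each rhombus of the third kind.
\<close>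
lemma dominant_iff_interior:
  assumes g: "gt_pattern m Q" and content: "\<And>k. sum (Q (Suc k)) {..<m} + u k = sum (Q k) {..<m} + v k"
    and u: "\<And>k. m \<le> k \<Longrightarrow> u k = 0" and v: "\<And>k. k \<in> I \<Longrightarrow> v (Suc k) \<le> v k"
  shows "dominant I u Q \<longleftrightarrow> (\<forall>i j. i + j + 2 \<le> m \<and> i + j \<in> I \<longrightarrow>
    u (Suc (i + j)) + sum (Q (Suc (Suc (i + j)))) {..<Suc j} + sum (Q (i + j)) {..<j}
      \<le> u (i + j) + sum (Q (Suc (i + j))) {..<j} + sum (Q (Suc (i + j))) {..<Suc j})"
    (is "_ \<longleftrightarrow> ?R")
proof
  assume "dominant I u Q"
  then show ?R unfolding dominant_def by blast
next
  assume R: ?R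
  have "u (Suc k) + sum (Q (Suc (Suc k))) {..<Suc j} + sum (Q k) {..<j}
       \<le> u k + sum (Q (Suc k)) {..<j} + sum (Q (Suc k)) {..<Suc j}" if k: "k \<in> I" for k j
  proof (cases "k + 2 \<le> m")
    case km: True
    show ?thesis
    proof (cases "j \<le> k")
      case True
      then have "k - j + j = k" by simp
      then show ?thesis using R[rule_format, of "k - j" j] km k by simp
    next
      case False
      have total: "sum (Q l) {..<i} = sum (Q l) {..<m}" if "l \<le> i" "l \<le> m" for l i
        using sum_zero_tail[of l i "Q l"] sum_zero_tail[of l m "Q l"] gt_pattern_support[OF g] that by simp
      have "sum (Q (Suc (Suc k))) {..<Suc j} = sum (Q (Suc (Suc k))) {..<m}" "sum (Q k) {..<j} = sum (Q k) {..<m}"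
        "sum (Q (Suc k)) {..<j} = sum (Q (Suc k)) {..<m}" "sum (Q (Suc k)) {..<Suc j} = sum (Q (Suc k)) {..<m}"
        using False km by (intro total; simp)+
      then show ?thesis using content[of k] content[of "Suc k"] v[OF k] by linarith
    qed
  next
    case False
    have "sum (Q k) {..<j} \<le> sum (Q (Suc k)) {..<j}"
      using gt_pattern_mono[OF g, of k "Suc k"] by (intro sum_mono) simp
    moreover have "Q (Suc (Suc k)) = Q (Suc k)"
      using gt_pattern_stable[OF g, of "Suc k"] gt_pattern_stable[OF g, of "Suc (Suc k)"] False by simp
    ultimately show ?thesis using u[of "Suc k"] False by simp
  qed
  then show "dominant I u Q" unfolding dominant_def by blast
qed

text \<open>
  The value at \<open>(i, j)\<close> is the sum of the right differences from \<open>(0, 0)\<close> to \<open>(i + j, 0)\<close> and of the first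
  \<open>j\<close> differences along the antidiagonal from there, which are the parts of \<open>Q (i + j)\<close>.
\<close>
definition hive_of_pattern :: "nat \<Rightarrow> (nat \<Rightarrow> nat) \<Rightarrow> (nat \<Rightarrow> nat \<Rightarrow> nat) \<Rightarrow> nat \<times> nat \<Rightarrow> int" where
  "hive_of_pattern m u Q = (\<lambda>(i, j) \<in> Delta m. int (sum u {..<i + j} + sum (Q (i + j)) {..<j}))"

lemma hive_of_pattern_apply:
  "i + j \<le> m \<Longrightarrow> hive_of_pattern m u Q (i, j) = int (sum u {..<i + j} + sum (Q (i + j)) {..<j})"
  by (simp add: hive_of_pattern_def Delta_def)

lemma hive_of_pattern_edge:
  "i + j < m \<Longrightarrow>
    hive_of_pattern m u Q (i, Suc j) - hive_of_pattern m u Q (Suc i, j) = int (Q (Suc (i + j)) j)"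
  by (simp add: hive_of_pattern_apply)

text \<open>
  Written in terms of antidiagonal differences, the first two rhombus inequalities become the two
  interlacing conditions between consecutive rows of a pattern.
\<close>
lemma skew_hive_iff:
  "skew_hive n h \<longleftrightarrow> h \<in> Delta (2 * n) \<rightarrow>\<^sub>E UNIV \<and>
    (\<forall>i j. i + j + 2 \<le> 2 * n \<longrightarrow> h (i, Suc (Suc j)) - h (Suc i, Suc j) \<le> h (i, Suc j) - h (Suc i, j)) \<and>
    (\<forall>i j. i + j + 2 \<le> 2 * n \<longrightarrow> h (i, Suc j) - h (Suc i, j) \<le> h (Suc i, Suc j) - h (Suc (Suc i), j)) \<and>
    (\<forall>i j. i + j + 2 \<le> 2 * n \<and> i + j \<in> {k. Suc k \<noteq> n} \<longrightarrow>
      h (i, j) + h (Suc i, Suc j) \<le> h (Suc i, j) + h (i, Suc j))"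
proof -
  have 1: "(\<forall>i j. 1 \<le> j \<and> {(i, j), (i + 1, j), (i, j + 1), (i + 1, j - 1)} \<subseteq> Delta (2 * n) \<longrightarrow>
        h (i, j) + h (i + 1, j) \<ge> h (i, j + 1) + h (i + 1, j - 1)) \<longleftrightarrow>
    (\<forall>i j. i + j + 2 \<le> 2 * n \<longrightarrow> h (i, Suc (Suc j)) - h (Suc i, Suc j) \<le> h (i, Suc j) - h (Suc i, j))"
    (is "?A \<longleftrightarrow> ?B")
  proof
    assume A: ?A
    show ?B
    proof (intro allI impI)
      fix i j assume "i + j + 2 \<le> 2 * n"
      then show "h (i, Suc (Suc j)) - h (Suc i, Suc j) \<le> h (i, Suc j) - h (Suc i, j)"
        using A[rule_format, of "Suc j" i] by (simp add: Delta_def)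
    qed
  next
    assume B: ?B
    show ?A
    proof (intro allI impI)
      fix i j assume "1 \<le> j \<and> {(i, j), (i + 1, j), (i, j + 1), (i + 1, j - 1)} \<subseteq> Delta (2 * n)"
      then obtain l where "j = Suc l" "i + l + 2 \<le> 2 * n" by (cases j) (auto simp: Delta_def)
      then show "h (i, j) + h (i + 1, j) \<ge> h (i, j + 1) + h (i + 1, j - 1)"
        using B[rule_format, of i l] by simp
    qed
  qed
  have 2: "(\<forall>i j. 1 \<le> i \<and> {(i, j), (i, j + 1), (i + 1, j), (i - 1, j + 1)} \<subseteq> Delta (2 * n) \<longrightarrow>
        h (i, j) + h (i, j + 1) \<ge> h (i + 1, j) + h (i - 1, j + 1)) \<longleftrightarrow>
    (\<forall>i j. i + j + 2 \<le> 2 * n \<longrightarrow> h (i, Suc j) - h (Suc i, j) \<le> h (Suc i, Suc j) - h (Suc (Suc i), j))"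
    (is "?A \<longleftrightarrow> ?B")
  proof
    assume A: ?A
    show ?B
    proof (intro allI impI)
      fix i j assume "i + j + 2 \<le> 2 * n"
      then show "h (i, Suc j) - h (Suc i, j) \<le> h (Suc i, Suc j) - h (Suc (Suc i), j)"
        using A[rule_format, of "Suc i" j] by (simp add: Delta_def)
    qed
  next
    assume B: ?B
    show ?A
    proof (intro allI impI)
      fix i j assume "1 \<le> i \<and> {(i, j), (i, j + 1), (i + 1, j), (i - 1, j + 1)} \<subseteq> Delta (2 * n)"
      then obtain l where "i = Suc l" "l + j + 2 \<le> 2 * n" by (cases i) (auto simp: Delta_def)
      then show "h (i, j) + h (i, j + 1) \<ge> h (i + 1, j) + h (i - 1, j + 1)"
        using B[rule_format, of l j] by simp
    qed
  qed
  have 3: "{(i + 1, j), (i, j + 1), (i, j), (i + 1, j + 1)} \<subseteq> Delta (2 * n) \<and> i + j + 1 \<noteq> n \<longleftrightarrow>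
      i + j + 2 \<le> 2 * n \<and> i + j \<in> {k. Suc k \<noteq> n}" for i j
    by (auto simp: Delta_def)
  show ?thesis unfolding skew_hive_def 1 2 3 by simp
qed

text \<open>
  The third rhombus inequality at \<open>(i, j)\<close> is the dominance condition for the letters \<open>k = i + j\<close> and
  \<open>k + 1\<close> at row \<open>j\<close>, and the boundary values express the content and the shape of the pattern. A hive
  yields natural numbers as antidiagonal differences because, for fixed \<open>i\<close>, they decrease
  in \<open>j\<close> down to a part of \<open>\<kappa>\<close>.
\<close>
lemma SkewHive_eq_image:
  fixes n :: nat and la \<mu> \<nu> \<rho> \<kappa> :: "nat \<Rightarrow> nat"
  defines "m \<equiv> 2 * n" and "u \<equiv> concat_seq n \<mu> \<rho>" and "v \<equiv> concat_seq n la \<nu>"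
  assumes u0: "\<And>k. m \<le> k \<Longrightarrow> u k = 0" and v0: "\<And>k. m \<le> k \<Longrightarrow> v k = 0"
    and v: "\<And>k. Suc k \<noteq> n \<Longrightarrow> v (Suc k) \<le> v k"
    and \<kappa>: "partition_of_length m \<kappa>"
  shows "SkewHive n la \<mu> \<nu> \<rho> \<kappa> = hive_of_pattern m u ` lr_patterns {k. Suc k \<noteq> n} m u v \<kappa>"
proof (intro equalityI subsetI)
  let ?I = "{k. Suc k \<noteq> n}"
  fix h assume "h \<in> hive_of_pattern m u ` lr_patterns ?I m u v \<kappa>"
  then obtain Q where h: "h = hive_of_pattern m u Q" and Q: "Q \<in> lr_patterns ?I m u v \<kappa>" by blast
  have g: "gt_pattern m Q" and Qm: "Q m = \<kappa>" and dom: "dominant ?I u Q"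
    and content: "\<And>k. sum (Q (Suc k)) {..<m} + u k = sum (Q k) {..<m} + v k"
    using Q by (auto simp: lr_patterns_def)
  note e = hive_of_pattern_edge[of _ _ m u Q, folded h]
  note a = hive_of_pattern_apply[of _ _ m u Q, folded h]
  have strips: "Q (Suc k) (Suc i) \<le> Q k i" "Q k i \<le> Q (Suc k) i" for k i
    using gt_pattern_step[OF g, of k] by (auto simp: hstrip_UNIV)
  have up: "h (0, k) = int (sum v {..<k})" if "k \<le> m" for k
  proof -
    have "sum (Q k) {..<k} = sum (Q k) {..<m}"
      using sum_zero_tail[OF that, of "Q k"] gt_pattern_support[OF g] by simp
    moreover have "sum (Q k) {..<m} + sum u {..<k} = sum v {..<k}"
    proof (induction k)
      case 0 then show ?case by (simp add: gt_pattern_0[OF g])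
    next
      case (Suc k) then show ?case using content[of k] by simp
    qed
    ultimately have "sum u {..<k} + sum (Q k) {..<k} = sum v {..<k}" by linarith
    moreover have "h (0, k) = int (sum u {..<k} + sum (Q k) {..<k})" using a[of 0 k] that by simp
    ultimately show ?thesis by simp
  qed
  have "skew_hive n h"
    unfolding skew_hive_iff m_def[symmetric]
  proof (intro conjI allI impI)
    show "h \<in> Delta m \<rightarrow>\<^sub>E UNIV" by (simp add: h hive_of_pattern_def)
  next
    fix i j assume "i + j + 2 \<le> m"
    then show "h (i, Suc (Suc j)) - h (Suc i, Suc j) \<le> h (i, Suc j) - h (Suc i, j)"
      using e[of i "Suc j"] e[of i j] strips(1)[of "Suc (i + j)" j] by simp
  next
    fix i j assume "i + j + 2 \<le> m"
    then show "h (i, Suc j) - h (Suc i, j) \<le> h (Suc i, Suc j) - h (Suc (Suc i), j)"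
      using e[of "Suc i" j] e[of i j] strips(2)[of "Suc (i + j)" j] by simp
  next
    fix i j assume ij: "i + j + 2 \<le> m \<and> i + j \<in> ?I"
    then have "u (Suc (i + j)) + sum (Q (Suc (Suc (i + j)))) {..<Suc j} + sum (Q (i + j)) {..<j}
       \<le> u (i + j) + sum (Q (Suc (i + j))) {..<j} + sum (Q (Suc (i + j))) {..<Suc j}"
      using dom unfolding dominant_def by blast
    moreover have "h (i, j) = int (sum u {..<i + j} + sum (Q (i + j)) {..<j})"
      "h (Suc i, j) = int (sum u {..<i + j} + u (i + j) + sum (Q (Suc (i + j))) {..<j})"
      "h (i, Suc j) = int (sum u {..<i + j} + u (i + j) + sum (Q (Suc (i + j))) {..<Suc j})"
      "h (Suc i, Suc j) = int (sum u {..<i + j} + u (i + j) + u (Suc (i + j)) + sum (Q (Suc (Suc (i + j)))) {..<Suc j})"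
      using ij a[of i j] a[of "Suc i" j] a[of i "Suc j"] a[of "Suc i" "Suc j"] by simp_all
    ultimately show "h (i, j) + h (Suc i, Suc j) \<le> h (Suc i, j) + h (i, Suc j)" by linarith
  qed
  moreover have "h (0, 0) = 0" using up[of 0] by simp
  moreover have "up_diff h k = int (v k)" if "k < m" for k
    using up[of k] up[of "Suc k"] that by (simp add: up_diff_def)
  moreover have "right_diff h k = int (u k)" if "k < m" for k
    using a[of k 0] a[of "Suc k" 0] that by (simp add: right_diff_def)
  moreover have "nw_diff n h k = int (\<kappa> k)" if "k < m" for k
  proof -
    have "2 * n - k = Suc (m - Suc k)" "m - Suc k + k < m" "Suc (m - Suc k + k) = m"
      using that by (auto simp: m_def)
    then show ?thesis using e[of "m - Suc k" k] Qm by (simp add: nw_diff_def m_def[symmetric])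
  qed
  ultimately show "h \<in> SkewHive n la \<mu> \<nu> \<rho> \<kappa>"
    by (simp add: SkewHive_def m_def[symmetric] u_def[symmetric] v_def[symmetric])
next
  let ?I = "{k. Suc k \<noteq> n}"
  fix h assume "h \<in> SkewHive n la \<mu> \<nu> \<rho> \<kappa>"
  then have hive: "skew_hive n h" and h0: "h (0, 0) = 0"
    and up: "\<And>k. k < m \<Longrightarrow> h (0, Suc k) - h (0, k) = int (v k)"
    and right: "\<And>k. k < m \<Longrightarrow> h (Suc k, 0) - h (k, 0) = int (u k)"
    and nw: "\<And>k. k < m \<Longrightarrow> h (m - Suc k, Suc k) - h (m - k, k) = int (\<kappa> k)"
    by (simp_all add: SkewHive_def m_def u_def v_def up_diff_def right_diff_def nw_diff_def)
  define e where "e i j = h (i, Suc j) - h (Suc i, j)" for i j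
  have ext: "h \<in> Delta m \<rightarrow>\<^sub>E UNIV"
    and e1: "\<And>i j. i + j + 2 \<le> m \<Longrightarrow> e i (Suc j) \<le> e i j"
    and e2: "\<And>i j. i + j + 2 \<le> m \<Longrightarrow> e i j \<le> e (Suc i) j"
    and e3: "\<And>i j. i + j + 2 \<le> m \<Longrightarrow> i + j \<in> ?I \<Longrightarrow>
      h (i, j) + h (Suc i, Suc j) \<le> h (Suc i, j) + h (i, Suc j)"
    using hive unfolding skew_hive_iff m_def[symmetric] e_def by blast+
  have last: "e i j = int (\<kappa> j)" if "Suc (i + j) = m" for i j
  proof -
    have "m - Suc j = i" "m - j = Suc i" "j < m" using that by auto
    then show ?thesis using nw[of j] by (simp add: e_def)
  qed
  have nonneg: "0 \<le> e i j" if "i + j < m" for i j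
    using that
  proof (induction "m - Suc (i + j)" arbitrary: j)
    case 0
    then show ?case using last[of i j] by simp
  next
    case (Suc d)
    have "0 \<le> e i (Suc j)" by (rule Suc.hyps(1)) (use Suc.hyps(2) in auto)
    also have "\<dots> \<le> e i j" by (rule e1) (use Suc.hyps(2) in auto)
    finally show ?case .
  qed
  define Q where "Q k j = (if j < min k m then nat (e (min k m - Suc j) j) else 0)" for k j
  have Qe: "int (Q (Suc (i + j)) j) = e i j" if "i + j < m" for i j
    using nonneg[OF that] that by (simp add: Q_def)
  have Q0: "Q k j = 0" if "k \<le> j" for k j using that by (simp add: Q_def)
  have Qm: "Q m = \<kappa>"
  proof
    fix j show "Q m j = \<kappa> j"
    proof (cases "j < m")
      case True
      then have "Suc (m - Suc j + j) = m" by simp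
      then show ?thesis using Qe[of "m - Suc j" j] last[of "m - Suc j" j] by simp
    next
      case False
      then show ?thesis using \<kappa> by (simp add: Q_def partition_of_length_def)
    qed
  qed
  have stable: "Q k = Q m" if "m \<le> k" for k using that by (simp add: Q_def fun_eq_iff)
  have step: "hstrip UNIV (Q k) (Q (Suc k))" for k
    unfolding hstrip_UNIV
  proof
    fix j
    show "Q k j \<le> Q (Suc k) j \<and> Q (Suc k) (Suc j) \<le> Q k j"
    proof (cases "k < m")
      case km: True
      show ?thesis
      proof (cases "j < k")
        case True
        then obtain i where k: "k = Suc (i + j)" using less_imp_Suc_add by (metis add.commute)
        have ij: "i + j + 2 \<le> m" using km k by simp
        have "int (Q k j) = e i j" "int (Q (Suc k) j) = e (Suc i) j" "int (Q (Suc k) (Suc j)) = e i (Suc j)"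
          using Qe[of i j] Qe[of "Suc i" j] Qe[of i "Suc j"] ij k by simp_all
        then show ?thesis using e1[OF ij] e2[OF ij] by simp
      qed (simp add: Q0)
    next
      case False
      then show ?thesis
        using stable[of k] stable[of "Suc k"] partition_decreasing[OF \<kappa>, of j] Qm by simp
    qed
  qed
  have g: "gt_pattern m Q"
  proof -
    have "Q 0 = (\<lambda>_. 0)" by (simp add: Q_def fun_eq_iff)
    then show ?thesis unfolding gt_pattern_def using step stable by blast
  qed
  have hQ: "h (i, j) = int (sum u {..<i + j} + sum (Q (i + j)) {..<j})" if "i + j \<le> m" for i j
    using that
  proof (induction j arbitrary: i)
    case 0
    then show ?case
    proof (induction i)
      case 0 then show ?case using h0 by simp
    next
      case (Suc i) then show ?case using right[of i] by simp
    qed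
  next
    case (Suc j)
    have "h (i, Suc j) = h (Suc i, j) + int (Q (Suc (i + j)) j)"
      using Qe[of i j] Suc.prems by (simp add: e_def)
    then show ?case using Suc.IH[of "Suc i"] Suc.prems by simp
  qed
  have up': "h (0, k) = int (sum v {..<k})" if "k \<le> m" for k
    using that
  proof (induction k)
    case 0 then show ?case using h0 by simp
  next
    case (Suc k) then show ?case using up[of k] by simp
  qed
  have total: "sum (Q k) {..<m} + sum u {..<k} = sum v {..<k}" if "k \<le> m" for k
  proof -
    have "sum (Q k) {..<m} = sum (Q k) {..<k}" by (rule sum_zero_tail[OF that Q0])
    moreover have "int (sum u {..<k} + sum (Q k) {..<k}) = int (sum v {..<k})"
      using hQ[of 0 k] up'[OF that] that by simp
    ultimately show ?thesis by linarith
  qed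
  have content: "sum (Q (Suc k)) {..<m} + u k = sum (Q k) {..<m} + v k" for k
  proof (cases "k < m")
    case True
    then show ?thesis using total[of k] total[of "Suc k"] by simp
  next
    case False
    then show ?thesis using stable[of k] stable[of "Suc k"] u0[of k] v0[of k] by simp
  qed
  have v': "v (Suc k) \<le> v k" if "k \<in> ?I" for k using v that by simp
  have "dominant ?I u Q \<longleftrightarrow> (\<forall>i j. i + j + 2 \<le> m \<and> i + j \<in> ?I \<longrightarrow>
    u (Suc (i + j)) + sum (Q (Suc (Suc (i + j)))) {..<Suc j} + sum (Q (i + j)) {..<j}
      \<le> u (i + j) + sum (Q (Suc (i + j))) {..<j} + sum (Q (Suc (i + j))) {..<Suc j})"
    by (rule dominant_iff_interior) (fact g, fact content, erule u0, erule v')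
  also have "\<dots>"
  proof (intro allI impI)
    fix i j assume ij: "i + j + 2 \<le> m \<and> i + j \<in> ?I"
    show "u (Suc (i + j)) + sum (Q (Suc (Suc (i + j)))) {..<Suc j} + sum (Q (i + j)) {..<j}
      \<le> u (i + j) + sum (Q (Suc (i + j))) {..<j} + sum (Q (Suc (i + j))) {..<Suc j}"
    proof -
      have "h (i, j) = int (sum u {..<i + j} + sum (Q (i + j)) {..<j})"
        "h (Suc i, j) = int (sum u {..<i + j} + u (i + j) + sum (Q (Suc (i + j))) {..<j})"
        "h (i, Suc j) = int (sum u {..<i + j} + u (i + j) + sum (Q (Suc (i + j))) {..<Suc j})"
        "h (Suc i, Suc j) = int (sum u {..<i + j} + u (i + j) + u (Suc (i + j)) + sum (Q (Suc (Suc (i + j)))) {..<Suc j})"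
        using ij hQ[of i j] hQ[of "Suc i" j] hQ[of i "Suc j"] hQ[of "Suc i" "Suc j"] by simp_all
      then show ?thesis using e3[of i j] ij by linarith
    qed
  qed
  finally have "Q \<in> lr_patterns ?I m u v \<kappa>" using g Qm content by (simp add: lr_patterns_def)
  moreover have "h = hive_of_pattern m u Q"
  proof
    fix c show "h c = hive_of_pattern m u Q c"
      using hQ ext by (cases c) (auto simp: hive_of_pattern_def Delta_def PiE_iff extensional_def)
  qed
  ultimately show "h \<in> hive_of_pattern m u ` lr_patterns ?I m u v \<kappa>" by blast
qed

lemma inj_on_hive_of_pattern: "inj_on (hive_of_pattern m u) (lr_patterns I m u v p)"
proof (rule inj_onI)
  fix P Q assume PQ: "P \<in> lr_patterns I m u v p" "Q \<in> lr_patterns I m u v p"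
    and eq: "hive_of_pattern m u P = hive_of_pattern m u Q"
  have g: "gt_pattern m P" "gt_pattern m Q" "P m = Q m" using PQ by (auto simp: lr_patterns_def)
  show "P = Q"
  proof (intro ext)
    fix k j
    show "P k j = Q k j"
    proof (cases "j < k \<and> k \<le> m")
      case True
      then have k: "k = Suc (k - Suc j + j)" "k - Suc j + j < m" by auto
      have "int (P k j) = int (Q k j)"
        using hive_of_pattern_edge[OF k(2), of u P] hive_of_pattern_edge[OF k(2), of u Q] eq k(1) by simp
      then show ?thesis by simp
    next
      case False
      then consider "k \<le> j" | "m \<le> k" by linarith
      then show ?thesis
        using gt_pattern_support[OF g(1), of k j] gt_pattern_support[OF g(2), of k j]
          gt_pattern_stable[OF g(1), of k] gt_pattern_stable[OF g(2), of k] g(3)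
        by cases simp_all
    qed
  qed
qed

theorem theorem2p13:
  fixes n :: nat and la \<mu> \<nu> \<rho> \<kappa> :: "nat \<Rightarrow> nat"
  assumes "n \<ge> 1"
    and "partition_of_length n la" and "partition_of_length n \<mu>"
    and "partition_of_length n \<nu>" and "partition_of_length n \<rho>"
    and "partition_of_length (2 * n) \<kappa>"
  shows "finite (SkewHive n la \<mu> \<nu> \<rho> \<kappa>) \<and>
         skew_LR_coeff la \<mu> \<nu> \<rho> \<kappa> = int (card (SkewHive n la \<mu> \<nu> \<rho> \<kappa>))"
proof -
  let ?N = "lr_patterns {k. Suc k \<noteq> n} (2 * n) (concat_seq n \<mu> \<rho>) (concat_seq n la \<nu>) \<kappa>"
  let ?h = "hive_of_pattern (2 * n) (concat_seq n \<mu> \<rho>)"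
  have hives: "SkewHive n la \<mu> \<nu> \<rho> \<kappa> = ?h ` ?N"
  proof (rule SkewHive_eq_image)
    fix k assume "2 * n \<le> k"
    then show "concat_seq n \<mu> \<rho> k = 0" "concat_seq n la \<nu> k = 0"
      using assms(4,5) by (auto simp: concat_seq_def partition_of_length_def)
  qed (use concat_decreasing[OF assms(2,4)] assms(6) in auto)
  have "skew_LR_coeff la \<mu> \<nu> \<rho> \<kappa> = int (card ?N)"
    unfolding skew_LR_coeff_def schur_coeff_eq[OF product_schur_expansion[OF assms(2-5)]]
    by (simp add: lr_number_def)
  then show ?thesis
    unfolding hives by (simp add: finite_lr_patterns card_image[OF inj_on_hive_of_pattern])
qed

end
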